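(* Let $f:\mathbb{S}^n\to\mathbb{R}$ be convex and $\beta$-smooth, and let $f^*=\min_{\mathbf{X}\in\mathcal{S}_n}f(\mathbf{X})$. Let $\{\mathbf{X}_t\}_{t\ge 1}$ (with associated unit vectors $\{\mathbf{v}_t\}_{t\ge 1}$) be a sequence produced by the Frank-Wolfe method with line-search described in the context (with either step-size option), and denote $h_t:=f(\mathbf{X}_t)-f^*$ for all $t\ge 1$. Then: (i) for all $t\ge 1$, $h_t=O(\beta/t)$. Moreover, suppose that there exists a minimizer $\mathbf{X}^*$ of $f$ over $\mathcal{S}_n$ such that $\delta:=\lambda_{n-1}(\nabla f(\mathbf{X}^* ))-\lambda_n(\nabla f(\mathbf{X}^* ))>0$. Then: (ii) there exists $T_0=O\left((\beta/\delta)^3\right)$ such that for all $t\ge T_0$, $$h_{t+1}\le h_t\left(1-\min\Big\{\frac{\delta}{12\beta},\frac12\Big\}\right);$$ (iii) for all $t\ge 1$, $$\Vert \mathbf{v}_t\mathbf{v}_t^\top-\mathbf{X}^*\Vert_F^2=O\left(\frac{\beta^2}{\delta^3}\,h_t\right).$$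
   Context: $\mathbb{S}^n$ is the space of real symmetric $n\times n$ matrices with the trace inner product $\langle\cdot,\cdot\rangle$ and Frobenius norm $\Vert\cdot\Vert_F$. $\mathcal{S}_n=\{\mathbf{X}\in\mathbb{S}^n : \mathbf{X}\succeq 0,\ \mathrm{Tr}(\mathbf{X})=1\}$. Eigenvalues of a symmetric matrix are ordered $\lambda_1\ge\lambda_2\ge\dots\ge\lambda_n$. A function $f:\mathbb{S}^n\to\mathbb{R}$ is $\beta$-smooth if it is differentiable and $\Vert\nabla f(\mathbf{X})-\nabla f(\mathbf{Y})\Vert_F\le\beta\Vert\mathbf{X}-\mathbf{Y}\Vert_F$ for all $\mathbf{X},\mathbf{Y}$. The notation $O(\cdot)$ hides absolute numerical constants. Frank-Wolfe method with line-search: $\mathbf{X}_1$ is an arbitrary point of $\mathcal{S}_n$. For $t=1,2,\dots$: let $\mathbf{v}_t$ be a unit eigenvector of $-\nabla f(\mathbf{X}_t)$ associated with its largest eigenvalue (computed exactly); choose $\eta_t\in[0,1]$ by one of the two options Option 1: $\eta_t\in\arg\min_{\eta\in[0,1]} f((1-\eta)\mathbf{X}_t+\eta\mathbf{v}_t\mathbf{v}_t^\top)$; Option 2: $\eta_t\in\arg\min_{\eta\in[0,1]} f(\mathbf{X}_t)+\eta\langle\mathbf{v}_t\mathbf{v}_t^\top-\mathbf{X}_t,\nabla f(\mathbf{X}_t)\rangle+\frac{\eta^2\beta}{2}\Vert\mathbf{X}_t-\mathbf{v}_t\mathbf{v}_t^\top\Vert_F^2$; and set $\mathbf{X}_{t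+1}=(1-\eta_t)\mathbf{X}_t+\eta_t\mathbf{v}_t\mathbf{v}_t^\top$.
   Formalization: Part (i) is stated for all t ≥ 2: at t = 1 the bound h_1 = O(β) fails, since X_1 is arbitrary and a linear f is β-smooth for every β > 0 yet can have arbitrarily large h_1. When β = 0 the undefined quotient δ/(12β) in (ii) is read as 0. *)

theory Defs
  imports Complex_Main "Jordan_Normal_Form.Char_Poly"
begin

text \<open>
  Matrices are those of the Jordan Normal Form library, whose dimension is a natural number
  rather than a type. This lets the absolute constants be quantified before the dimension.
  A function on \<open>\<S>\<^sup>n\<close> is represented by a function on all real matrices, of which only the
  values on \<open>sym_mats n\<close> are ever used.
\<close>

definition sym_mats :: "nat \<Rightarrow> real mat set" where
  "sym_mats n = {X \<in> carrier_mat n n. transpose_mat X = X}"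

definition mat_trace :: "real mat \<Rightarrow> real" where
  "mat_trace X = sum_list (diag_mat X)"

definition mat_inner :: "real mat \<Rightarrow> real mat \<Rightarrow> real" where
  "mat_inner X Y = mat_trace (transpose_mat X * Y)"

definition fro_norm :: "real mat \<Rightarrow> real" where
  "fro_norm X = sqrt (mat_inner X X)"

definition outer :: "real vec \<Rightarrow> real mat" where
  "outer v = mat (dim_vec v) (dim_vec v) (\<lambda>(i, j). v $ i * v $ j)"

definition psd :: "nat \<Rightarrow> real mat \<Rightarrow> bool" where
  "psd n X \<longleftrightarrow> X \<in> sym_mats n \<and> (\<forall>u \<in> carrier_vec n. u \<bullet> (X *\<^sub>v u) \<ge> 0)"

definition spectrahedron :: "nat \<Rightarrow> real mat set" where
  "spectrahedron n = {X. psd n X \<and> mat_trace X = 1}"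

text \<open>
  The eigenvalues, repeated according to multiplicity, in descending order. The list exists
  whenever the characteristic polynomial splits over the reals, hence for symmetric matrices.
  \<open>eigval A k\<close> is \<open>\<lambda>\<^sub>k(A)\<close>, counted from \<open>k = 1\<close>.
\<close>

definition eigvals :: "real mat \<Rightarrow> real list" where
  "eigvals A = (THE es. char_poly A = (\<Prod>e\<leftarrow>es. [:- e, 1:]) \<and> sorted_wrt (\<ge>) es)"

definition eigval :: "real mat \<Rightarrow> nat \<Rightarrow> real" where
  "eigval A k = eigvals A ! (k - 1)"

definition convex_sym :: "nat \<Rightarrow> (real mat \<Rightarrow> real) \<Rightarrow> bool" where
  "convex_sym n f \<longleftrightarrow>
     (\<forall>X \<in> sym_mats n. \<forall>Y \<in> sym_mats n. \<forall>u \<in> {0..1}.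
        f ((1 - u) \<cdot>\<^sub>m X + u \<cdot>\<^sub>m Y) \<le> (1 - u) * f X + u * f Y)"

text \<open>
  Frechet differentiability on the space of symmetric matrices, with the derivative represented
  by a symmetric matrix through the trace inner product; such a representative is unique.
\<close>

definition has_gradient :: "nat \<Rightarrow> (real mat \<Rightarrow> real) \<Rightarrow> real mat \<Rightarrow> real mat \<Rightarrow> bool" where
  "has_gradient n f X G \<longleftrightarrow> G \<in> sym_mats n \<and>
     (\<forall>\<epsilon>>0. \<exists>d>0. \<forall>Y \<in> sym_mats n. fro_norm (Y - X) < d \<longrightarrow>
        \<bar>f Y - f X - mat_inner G (Y - X)\<bar> \<le> \<epsilon> * fro_norm (Y - X))"

definition gradient :: "nat \<Rightarrow> (real mat \<Rightarrow> real) \<Rightarrow> real mat \<Rightarrow> real mat" where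
  "gradient n f X = (THE G. has_gradient n f X G)"

definition smooth_sym :: "nat \<Rightarrow> real \<Rightarrow> (real mat \<Rightarrow> real) \<Rightarrow> bool" where
  "smooth_sym n \<beta> f \<longleftrightarrow>
     (\<forall>X \<in> sym_mats n. \<exists>G. has_gradient n f X G) \<and>
     (\<forall>X \<in> sym_mats n. \<forall>Y \<in> sym_mats n.
        fro_norm (gradient n f X - gradient n f Y) \<le> \<beta> * fro_norm (X - Y))"

definition exact_line_search ::
  "(real mat \<Rightarrow> real) \<Rightarrow> real mat \<Rightarrow> real vec \<Rightarrow> real \<Rightarrow> bool" where
  "exact_line_search f X v \<eta> \<longleftrightarrow>
     is_arg_min (\<lambda>s. f ((1 - s) \<cdot>\<^sub>m X + s \<cdot>\<^sub>m outer v)) (\<lambda>s. s \<in> {0..1}) \<eta>"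

definition quadratic_line_search ::
  "nat \<Rightarrow> real \<Rightarrow> (real mat \<Rightarrow> real) \<Rightarrow> real mat \<Rightarrow> real vec \<Rightarrow> real \<Rightarrow> bool" where
  "quadratic_line_search n \<beta> f X v \<eta> \<longleftrightarrow>
     is_arg_min
       (\<lambda>s. f X + s * mat_inner (outer v - X) (gradient n f X)
              + s\<^sup>2 * \<beta> / 2 * (fro_norm (X - outer v))\<^sup>2)
       (\<lambda>s. s \<in> {0..1}) \<eta>"

text \<open>
  Iterations are numbered from 1; \<open>X 0\<close> and \<open>v 0\<close> play no role. The option for the step size may
  differ between iterations, which covers in particular using the same option throughout.
\<close>

definition frank_wolfe ::
  "nat \<Rightarrow> real \<Rightarrow> (real mat \<Rightarrow> real) \<Rightarrow> (nat \<Rightarrow> real mat) \<Rightarrow> (nat \<Rightarrow> real vec) \<Rightarrow> bool" where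
  "frank_wolfe n \<beta> f X v \<longleftrightarrow> X 1 \<in> spectrahedron n \<and>
     (\<forall>t\<ge>1.
        eigenvector (- gradient n f (X t)) (v t) (eigval (- gradient n f (X t)) 1) \<and>
        v t \<bullet> v t = 1 \<and>
        (\<exists>\<eta> \<in> {0..1}.
           (exact_line_search f (X t) (v t) \<eta> \<or> quadratic_line_search n \<beta> f (X t) (v t) \<eta>) \<and>
           X (Suc t) = (1 - \<eta>) \<cdot>\<^sub>m X t + \<eta> \<cdot>\<^sub>m outer (v t)))"

definition opt_gap :: "nat \<Rightarrow> (real mat \<Rightarrow> real) \<Rightarrow> real mat \<Rightarrow> real" where
  "opt_gap n f X = f X - (INF Y \<in> spectrahedron n. f Y)"

end

theory Submission
  imports Defs
begin

text \<open>
  For \<open>V\<^sub>t = v\<^sub>t v\<^sub>t\<^sup>T\<close>, the duality gap \<open>g\<^sub>t = \<langle>X\<^sub>t - V\<^sub>t, \<nabla>f(X\<^sub>t)\<rangle>\<close> dominates \<open>h\<^sub>t\<close>, and both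
  step-size options give \<open>h\<^sub>t\<^sub>+\<^sub>1 \<le> h\<^sub>t - s g\<^sub>t + s\<^sup>2 \<beta>/2 \<parallel>X\<^sub>t - V\<^sub>t\<parallel>\<^sup>2\<close> for every \<open>s \<in> [0, 1]\<close>. With
  \<open>s = 2/t\<close> and the diameter bound this is the sublinear rate.

  A spectral gap \<open>\<delta>\<close> at the minimizer forces \<open>X\<^sup>* = x x\<^sup>T\<close> and
  \<open>\<langle>Y - X\<^sup>*, \<nabla>f(X\<^sup>*)\<rangle> \<ge> \<delta>/2 \<parallel>Y - X\<^sup>*\<parallel>\<^sup>2\<close> on the spectrahedron. For \<open>Y = X\<^sub>t\<close> convexity turns this
  into \<open>h\<^sub>t \<ge> \<delta>/2 \<parallel>X\<^sub>t - X\<^sup>*\<parallel>\<^sup>2\<close>. For \<open>Y = V\<^sub>t\<close>, optimality of \<open>V\<^sub>t\<close> for the linearized problem at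
  \<open>X\<^sub>t\<close> and smoothness give \<open>\<parallel>V\<^sub>t - X\<^sup>*\<parallel> \<le> 2\<beta>/\<delta> \<parallel>X\<^sub>t - X\<^sup>*\<parallel>\<close>, with no appeal to the Davis-Kahan
  theorem. Once \<open>\<beta> \<parallel>X\<^sub>t - X\<^sup>*\<parallel> \<le> \<delta>/6\<close>, the gradient at \<open>X\<^sub>t\<close> retains a gap \<open>\<delta>/3\<close>, so that
  \<open>g\<^sub>t \<ge> \<delta>/6 \<parallel>X\<^sub>t - V\<^sub>t\<parallel>\<^sup>2\<close>, and \<open>s\<close> of order \<open>\<delta>/\<beta>\<close> yields linear convergence; by the sublinear
  rate this holds from \<open>t\<close> of order \<open>(\<beta>/\<delta>)\<^sup>3\<close> on.
\<close>

section \<open>The trace inner product\<close>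

declare minus_carrier_mat [simp]

lemma mat_inner_eq_sum:
  assumes "X \<in> carrier_mat n n" "Y \<in> carrier_mat n n"
  shows "mat_inner X Y = (\<Sum>i<n. \<Sum>j<n. X $$ (i, j) * Y $$ (i, j))"
proof -
  have "mat_inner X Y = (\<Sum>j<n. \<Sum>i<n. X $$ (i, j) * Y $$ (i, j))"
    using assms
    by (simp add: mat_inner_def mat_trace_def diag_mat_def sum_list_sum_nth scalar_prod_def
        atLeast0LessThan)
  then show ?thesis
    by (subst sum.swap)
qed

lemma mat_inner_commute:
  assumes "X \<in> carrier_mat n n" "Y \<in> carrier_mat n n"
  shows "mat_inner X Y = mat_inner Y X"
  using assms by (simp add: mat_inner_eq_sum[of _ n] mult.commute)

lemma mat_inner_add_left:
  assumes "X \<in> carrier_mat n n" "Y \<in> carrier_mat n n" "Z \<in> carrier_mat n n"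
  shows "mat_inner (X + Y) Z = mat_inner X Z + mat_inner Y Z"
  using assms by (simp add: mat_inner_eq_sum[of _ n] sum.distrib algebra_simps)

lemma mat_inner_add_right:
  assumes "X \<in> carrier_mat n n" "Y \<in> carrier_mat n n" "Z \<in> carrier_mat n n"
  shows "mat_inner X (Y + Z) = mat_inner X Y + mat_inner X Z"
  using assms by (simp add: mat_inner_eq_sum[of _ n] sum.distrib algebra_simps)

lemma mat_inner_minus_left:
  assumes "X \<in> carrier_mat n n" "Y \<in> carrier_mat n n" "Z \<in> carrier_mat n n"
  shows "mat_inner (X - Y) Z = mat_inner X Z - mat_inner Y Z"
  using assms by (simp add: mat_inner_eq_sum[of _ n] sum_subtractf algebra_simps)

lemma mat_inner_minus_right:
  assumes "X \<in> carrier_mat n n" "Y \<in> carrier_mat n n" "Z \<in> carrier_mat n n"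
  shows "mat_inner X (Y - Z) = mat_inner X Y - mat_inner X Z"
  using assms by (simp add: mat_inner_eq_sum[of _ n] sum_subtractf algebra_simps)

lemma mat_inner_smult_left:
  assumes "X \<in> carrier_mat n n" "Y \<in> carrier_mat n n"
  shows "mat_inner (c \<cdot>\<^sub>m X) Y = c * mat_inner X Y"
  using assms by (simp add: mat_inner_eq_sum[of _ n] sum_distrib_left algebra_simps)

lemma mat_inner_smult_right:
  assumes "X \<in> carrier_mat n n" "Y \<in> carrier_mat n n"
  shows "mat_inner X (c \<cdot>\<^sub>m Y) = c * mat_inner X Y"
  using assms by (simp add: mat_inner_eq_sum[of _ n] sum_distrib_left algebra_simps)

lemmas mat_inner_linear =
  mat_inner_add_left mat_inner_add_right mat_inner_minus_left mat_inner_minus_right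
  mat_inner_smult_left mat_inner_smult_right

lemma mat_inner_self_nonneg:
  assumes "X \<in> carrier_mat n n"
  shows "mat_inner X X \<ge> 0"
  using assms by (simp add: mat_inner_eq_sum[of _ n] sum_nonneg)

lemma mat_inner_self_eq_0:
  assumes "X \<in> carrier_mat n n" "mat_inner X X = 0"
  shows "X = 0\<^sub>m n n"
proof (rule eq_matI)
  fix i j assume "i < dim_row (0\<^sub>m n n :: real mat)" "j < dim_col (0\<^sub>m n n :: real mat)"
  then have ij: "i < n" "j < n" by auto
  have "(\<Sum>i<n. \<Sum>j<n. X $$ (i, j) * X $$ (i, j)) = 0"
    using mat_inner_eq_sum[OF assms(1) assms(1)] assms(2) by simp
  then have "(\<Sum>j<n. X $$ (i, j) * X $$ (i, j)) = 0"
    using ij by (subst (asm) sum_nonneg_eq_0_iff) (auto intro: sum_nonneg)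
  then have "X $$ (i, j) * X $$ (i, j) = 0"
    using ij by (subst (asm) sum_nonneg_eq_0_iff) auto
  then show "X $$ (i, j) = 0\<^sub>m n n $$ (i, j)"
    using ij by simp
qed (use assms in auto)

lemma fro_norm_power2:
  assumes "X \<in> carrier_mat n n"
  shows "(fro_norm X)\<^sup>2 = mat_inner X X"
  using mat_inner_self_nonneg[OF assms] by (simp add: fro_norm_def)

lemma fro_norm_nonneg:
  assumes "X \<in> carrier_mat n n"
  shows "fro_norm X \<ge> 0"
  using mat_inner_self_nonneg[OF assms] by (simp add: fro_norm_def)

lemma fro_norm_smult:
  assumes "X \<in> carrier_mat n n"
  shows "fro_norm (c \<cdot>\<^sub>m X) = \<bar>c\<bar> * fro_norm X"
  using assms
  by (simp add: fro_norm_def mat_inner_linear[of _ n] real_sqrt_mult flip: mult.assoc)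

lemma fro_norm_commute:
  assumes "X \<in> carrier_mat n n" "Y \<in> carrier_mat n n"
  shows "fro_norm (X - Y) = fro_norm (Y - X)"
  using assms unfolding fro_norm_def
  by (intro arg_cong[where f = sqrt])
     (simp add: mat_inner_linear[of _ n] mat_inner_commute[of X n Y])

lemma fro_norm_eq_0:
  assumes "X \<in> carrier_mat n n" "Y \<in> carrier_mat n n" "fro_norm (X - Y) = 0"
  shows "X = Y"
proof -
  have "X - Y = 0\<^sub>m n n"
    using assms fro_norm_power2[of "X - Y" n] by (intro mat_inner_self_eq_0) auto
  have "X $$ (i, j) = Y $$ (i, j)" if "i < n" "j < n" for i j
    using arg_cong[OF \<open>X - Y = 0\<^sub>m n n\<close>, of "\<lambda>Z. Z $$ (i, j)"] that assms by simp
  then show ?thesis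
    using assms by (intro eq_matI) auto
qed

lemma mat_inner_Cauchy_Schwarz:
  assumes X: "X \<in> carrier_mat n n" and Y: "Y \<in> carrier_mat n n"
  shows "\<bar>mat_inner X Y\<bar> \<le> fro_norm X * fro_norm Y"
proof (cases "mat_inner Y Y = 0")
  case True
  then have "mat_inner X Y = 0"
    using mat_inner_self_eq_0[OF Y] X by (simp add: mat_inner_eq_sum[of _ n])
  then show ?thesis
    using X Y by (simp add: fro_norm_nonneg[of _ n])
next
  case False
  define a where "a = mat_inner X X"
  define b where "b = mat_inner X Y"
  define c where "c = mat_inner Y Y"
  have c: "c > 0"
    using False mat_inner_self_nonneg[OF Y] by (simp add: c_def)
  \<comment> \<open>The matrix is c times the component of X orthogonal to Y; its squared norm is c
    (a c - b^2).\<close>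
  have "0 \<le> mat_inner (c \<cdot>\<^sub>m X - b \<cdot>\<^sub>m Y) (c \<cdot>\<^sub>m X - b \<cdot>\<^sub>m Y)"
    using X Y by (intro mat_inner_self_nonneg[of _ n]) auto
  also have "\<dots> = c * (a * c - b\<^sup>2)"
    using X Y
    by (simp add: mat_inner_linear[of _ n] mat_inner_commute[of Y n X] a_def b_def c_def
        power2_eq_square algebra_simps)
  finally have "b\<^sup>2 \<le> a * c"
    using c by (simp add: zero_le_mult_iff)
  then have "\<bar>b\<bar> \<le> sqrt (a * c)"
    using real_sqrt_le_mono[of "b\<^sup>2" "a * c"] by simp
  then show ?thesis
    by (simp add: fro_norm_def a_def b_def c_def real_sqrt_mult)
qed

lemma fro_norm_diff_power2:
  assumes "X \<in> carrier_mat n n" "Y \<in> carrier_mat n n"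
  shows "(fro_norm (X - Y))\<^sup>2 = mat_inner X X - 2 * mat_inner X Y + mat_inner Y Y"
  using assms
  by (simp add: fro_norm_power2[of _ n] mat_inner_linear[of _ n] mat_inner_commute[of Y n X])

section \<open>Rank-one and symmetric matrices\<close>

lemma sym_matsD:
  assumes "X \<in> sym_mats n"
  shows "X \<in> carrier_mat n n" "transpose_mat X = X"
  using assms unfolding sym_mats_def by blast+

lemma sym_mats_carrier [simp, intro]: "X \<in> sym_mats n \<Longrightarrow> X \<in> carrier_mat n n"
  by (rule sym_matsD)

lemma sym_mats_index:
  assumes "A \<in> sym_mats n" "i < n" "j < n"
  shows "A $$ (i, j) = A $$ (j, i)"
proof -
  have "A $$ (i, j) = transpose_mat A $$ (i, j)"
    by (simp only: sym_matsD(2)[OF assms(1)])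
  also have "\<dots> = A $$ (j, i)"
    using sym_matsD(1)[OF assms(1)] assms(2,3) by (intro index_transpose_mat) auto
  finally show ?thesis .
qed

lemma sym_matsI:
  assumes "A \<in> carrier_mat n n" "\<And>i j. i < n \<Longrightarrow> j < n \<Longrightarrow> A $$ (i, j) = A $$ (j, i)"
  shows "A \<in> sym_mats n"
proof -
  have "transpose_mat A = A"
  proof (rule eq_matI)
    fix i j assume "i < dim_row A" "j < dim_col A"
    then show "transpose_mat A $$ (i, j) = A $$ (i, j)"
      using assms(1) assms(2)[of j i] by simp
  qed (use assms(1) in auto)
  then show ?thesis
    using assms(1) unfolding sym_mats_def by blast
qed

lemma sym_mats_add [intro]:
  assumes "A \<in> sym_mats n" "B \<in> sym_mats n"
  shows "A + B \<in> sym_mats n"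
proof (rule sym_matsI)
  fix i j assume "i < n" "j < n"
  then show "(A + B) $$ (i, j) = (A + B) $$ (j, i)"
    using sym_mats_index[OF assms(1)] sym_mats_index[OF assms(2)] sym_matsD(1)[OF assms(2)]
    by simp
qed (use assms in simp)

lemma sym_mats_smult [intro]:
  assumes "A \<in> sym_mats n"
  shows "c \<cdot>\<^sub>m A \<in> sym_mats n"
proof (rule sym_matsI)
  fix i j assume "i < n" "j < n"
  then show "(c \<cdot>\<^sub>m A) $$ (i, j) = (c \<cdot>\<^sub>m A) $$ (j, i)"
    using sym_mats_index[OF assms] sym_matsD(1)[OF assms] by simp
qed (use assms in simp)

lemma sym_mats_uminus [intro]:
  assumes "A \<in> sym_mats n"
  shows "- A \<in> sym_mats n"
proof (rule sym_matsI)
  fix i j assume "i < n" "j < n"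
  then show "(- A) $$ (i, j) = (- A) $$ (j, i)"
    using sym_mats_index[OF assms] sym_matsD(1)[OF assms] by simp
qed (use assms in simp)

lemma sym_mats_minus [intro]:
  assumes "A \<in> sym_mats n" "B \<in> sym_mats n"
  shows "A - B \<in> sym_mats n"
proof (rule sym_matsI)
  fix i j assume "i < n" "j < n"
  then show "(A - B) $$ (i, j) = (A - B) $$ (j, i)"
    using sym_mats_index[OF assms(1)] sym_mats_index[OF assms(2)] sym_matsD(1)[OF assms(2)]
    by simp
qed (use assms in simp)

lemma sym_mats_scalar_prod:
  assumes A: "A \<in> sym_mats n" and "u \<in> carrier_vec n" "w \<in> carrier_vec n"
  shows "u \<bullet> (A *\<^sub>v w) = w \<bullet> (A *\<^sub>v u)"
proof -
  have "u \<bullet> (A *\<^sub>v w) = (transpose_mat A *\<^sub>v u) \<bullet> w"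
    using assms by (subst transpose_vec_mult_scalar[of _ n n]) auto
  also have "\<dots> = (A *\<^sub>v u) \<bullet> w"
    by (simp only: sym_matsD(2)[OF A])
  also have "\<dots> = w \<bullet> (A *\<^sub>v u)"
    using sym_matsD(1)[OF A] assms(2,3) by (intro comm_scalar_prod[of _ n]) auto
  finally show ?thesis .
qed

lemma outer_sym_mats [simp, intro]: "u \<in> carrier_vec n \<Longrightarrow> outer u \<in> sym_mats n"
  by (rule sym_matsI) (auto simp: outer_def)

lemma mat_inner_outer:
  assumes "u \<in> carrier_vec n" "M \<in> carrier_mat n n"
  shows "mat_inner (outer u) M = u \<bullet> (M *\<^sub>v u)"
  using assms
  by (simp add: mat_inner_eq_sum[of _ n] outer_def scalar_prod_def atLeast0LessThan
      sum_distrib_left algebra_simps)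

lemma outer_mult_vec:
  assumes "u \<in> carrier_vec n" "w \<in> carrier_vec n"
  shows "outer u *\<^sub>v w = (u \<bullet> w) \<cdot>\<^sub>v u"
  using assms
  by (intro eq_vecI)
     (auto simp: outer_def scalar_prod_def atLeast0LessThan sum_distrib_right sum_distrib_left
      algebra_simps)

lemma mat_inner_outer_outer:
  assumes "u \<in> carrier_vec n" "w \<in> carrier_vec n"
  shows "mat_inner (outer u) (outer w) = (u \<bullet> w)\<^sup>2"
  using assms
  by (simp add: mat_inner_outer[of _ n] outer_mult_vec[of _ n] comm_scalar_prod[of w n u]
      power2_eq_square)

lemma mat_trace_outer: "mat_trace (outer u) = u \<bullet> u"
  by (simp add: mat_trace_def diag_mat_def outer_def sum_list_sum_nth scalar_prod_def
      atLeast0LessThan)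

section \<open>The spectral theorem\<close>

lemma nonzero_vec_index:
  assumes "x \<in> carrier_vec n" "x \<noteq> 0\<^sub>v n"
  shows "\<exists>i<n. x $ i \<noteq> 0"
proof (rule ccontr)
  assume "\<not> ?thesis"
  then have "x = 0\<^sub>v n"
    using assms(1) by (intro eq_vecI) auto
  with assms(2) show False ..
qed

lemma scalar_prod_self_pos:
  fixes x :: "real vec"
  assumes "x \<in> carrier_vec n" "x \<noteq> 0\<^sub>v n"
  shows "x \<bullet> x > 0"
proof -
  obtain i where "i < n" "x $ i \<noteq> 0"
    using nonzero_vec_index[OF assms] by blast
  then have "0 < x $ i * x $ i"
    by (simp add: zero_less_mult_iff linorder_neq_iff disj_commute)
  then have "0 < (\<Sum>i<n. x $ i * x $ i)"
    using \<open>i < n\<close> by (intro sum_pos2[of _ i]) auto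
  then show ?thesis
    using assms(1) by (simp add: scalar_prod_def atLeast0LessThan)
qed

text \<open>Householder reflection: with e the first unit vector and w = e - v, the map I - 2 w w^T
  / (w . w) swaps e and v. It serves to move an eigenvector onto a coordinate axis.\<close>

lemma reflection_exists:
  assumes v: "v \<in> carrier_vec n" "v \<bullet> v = 1" and n: "n > 0"
  shows "\<exists>H \<in> sym_mats n. H * H = 1\<^sub>m n \<and> H *\<^sub>v unit_vec n 0 = (v :: real vec)"
proof -
  define e where "e = (unit_vec n 0 :: real vec)"
  define w where "w = e - v"
  define r where "r = w \<bullet> w"
  define W where "W = outer w"
  have e: "e \<in> carrier_vec n" and w: "w \<in> carrier_vec n"
    using v by (auto simp: e_def w_def)
  have W: "W \<in> carrier_mat n n"
    unfolding W_def using w by auto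
  have we: "w \<bullet> e = 1 - v $ 0"
    using v n by (simp add: w_def e_def minus_scalar_prod_distrib[of _ n])
  \<comment> \<open>Holds because e and v are both unit vectors; it makes the reflection subtract
    exactly w from e.\<close>
  have r: "r = 2 * (w \<bullet> e)"
    unfolding we using v n
    by (simp add: r_def w_def e_def minus_scalar_prod_distrib[of _ n]
        scalar_prod_minus_distrib[of _ n])
  show ?thesis
  proof (cases "r = 0")
    case True
    have "(\<Sum>i<n. w $ i * w $ i) = 0"
      using True w by (simp add: r_def scalar_prod_def atLeast0LessThan)
    then have "\<forall>i<n. w $ i = 0"
      by (subst (asm) sum_nonneg_eq_0_iff) auto
    then have "e = v"
      using v e by (intro eq_vecI) (auto simp: w_def)
    then have "1\<^sub>m n *\<^sub>v unit_vec n 0 = v"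
      using v by (simp add: e_def)
    moreover have "1\<^sub>m n \<in> sym_mats n"
      by (rule sym_matsI) auto
    ultimately show ?thesis
      by (intro bexI[of _ "1\<^sub>m n"]) auto
  next
    case False
    define c where "c = 2 / r"
    define H where "H = 1\<^sub>m n - c \<cdot>\<^sub>m W"
    have WW: "W * W = r \<cdot>\<^sub>m W"
      using w
      by (intro eq_matI)
         (auto simp: W_def outer_def r_def scalar_prod_def sum_distrib_left sum_distrib_right
           algebra_simps)
    have "H * H = (1\<^sub>m n - c \<cdot>\<^sub>m W) - c \<cdot>\<^sub>m (W - c \<cdot>\<^sub>m (W * W))"
      using W unfolding H_def
      by (simp add: minus_mult_distrib_mat[of _ n n _ _ n] mult_minus_distrib_mat[of _ n n _ n]
          mult_smult_distrib[of _ n n _ n] mult_smult_assoc_mat[of _ n n _ n])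
    also have "\<dots> = 1\<^sub>m n"
      unfolding WW using W False by (intro eq_matI) (auto simp: c_def)
    finally have HH: "H * H = 1\<^sub>m n" .
    have "H *\<^sub>v e = e - c \<cdot>\<^sub>v ((w \<bullet> e) \<cdot>\<^sub>v w)"
    proof -
      have "H *\<^sub>v e = 1\<^sub>m n *\<^sub>v e - (c \<cdot>\<^sub>m W) *\<^sub>v e"
        unfolding H_def using W e by (intro minus_mult_distrib_mat_vec[of _ n n]) auto
      also have "(c \<cdot>\<^sub>m W) *\<^sub>v e = c \<cdot>\<^sub>v (W *\<^sub>v e)"
        using W e by (intro eq_vecI) auto
      finally show ?thesis
        using e w by (simp add: W_def outer_mult_vec[of _ n])
    qed
    also have "\<dots> = v"
      using v e False r by (intro eq_vecI) (auto simp: c_def w_def)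
    finally have "H *\<^sub>v e = v" .
    moreover have "H \<in> sym_mats n"
      unfolding H_def W_def using w by (intro sym_mats_minus sym_mats_smult sym_matsI[of "1\<^sub>m n"]) auto
    ultimately show ?thesis
      using HH by (auto simp: e_def)
  qed
qed

text \<open>For a complex eigenvector w, the number w* A w is its own conjugate by symmetry and
  equals a times |w|^2 > 0.\<close>

lemma sym_eigenvalue_real:
  fixes a :: complex
  assumes A: "A \<in> sym_mats n" and ev: "eigenvalue (map_mat complex_of_real A) a"
  shows "Im a = 0"
proof -
  have Ac: "A \<in> carrier_mat n n"
    using A by (rule sym_matsD)
  obtain w where w: "w \<in> carrier_vec n" "w \<noteq> 0\<^sub>v n"
      "map_mat complex_of_real A *\<^sub>v w = a \<cdot>\<^sub>v w"
    using ev Ac by (auto simp: eigenvalue_def eigenvector_def)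
  define q where "q = (\<Sum>i<n. \<Sum>j<n. cnj (w $ i) * (of_real (A $$ (i, j)) * w $ j))"
  define s where "s = (\<Sum>i<n. (cmod (w $ i))\<^sup>2)"
  have row: "(\<Sum>j<n. of_real (A $$ (i, j)) * w $ j) = a * w $ i" if "i < n" for i
    using arg_cong[OF w(3), of "\<lambda>z. z $ i"] that Ac w(1)
    by (simp add: scalar_prod_def atLeast0LessThan)
  have "q = (\<Sum>i<n. cnj (w $ i) * (a * w $ i))"
    unfolding q_def by (intro sum.cong) (simp_all add: row flip: sum_distrib_left)
  also have "\<dots> = a * of_real s"
    unfolding s_def of_real_sum sum_distrib_left
    by (intro sum.cong) (simp_all add: complex_norm_square mult_ac del: of_real_power)
  finally have q: "q = a * of_real s" .
  have "cnj q = (\<Sum>i<n. \<Sum>j<n. w $ i * (of_real (A $$ (j, i)) * cnj (w $ j)))"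
    unfolding q_def cnj_sum
    by (intro sum.cong refl) (simp add: sym_mats_index[OF A])
  also have "\<dots> = q"
    unfolding q_def by (subst sum.swap) (simp add: mult_ac)
  finally have "Im q = 0"
    by (simp add: complex_eq_iff)
  moreover have "s > 0"
  proof -
    obtain i where "i < n" "w $ i \<noteq> 0"
      using nonzero_vec_index[OF w(1,2)] by blast
    then show ?thesis
      unfolding s_def by (intro sum_pos2[of _ i]) auto
  qed
  ultimately show ?thesis
    using q by simp
qed

text \<open>Factor over the complex numbers, replace every root by its real part, and pull the
  identity back along the injective embedding of coefficients.\<close>

lemma sym_char_poly_splits:
  assumes A: "A \<in> sym_mats n"
  shows "\<exists>es. char_poly A = (\<Prod>e\<leftarrow>es. [:- e, 1:])"
proof -
  have Ac: "A \<in> carrier_mat n n"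
    using A by (rule sym_matsD)
  let ?C = "map_mat complex_of_real A"
  obtain as where as: "char_poly ?C = (\<Prod>a\<leftarrow>as. [:- a, 1:])"
    using char_poly_factorized[of ?C n] Ac by auto
  interpret map_poly_inj_comm_ring_hom complex_of_real
    by unfold_locales
  have "complex_of_real (Re a) = a" if "a \<in> set as" for a
  proof -
    have "poly (char_poly ?C) a = 0"
      unfolding as poly_prod_list using that by (intro prod_list_zero_iff[THEN iffD2]) force
    then show ?thesis
      using sym_eigenvalue_real[OF A, of a] Ac
      by (simp add: eigenvalue_root_char_poly[of ?C n] complex_eq_iff)
  qed
  then have "map_poly complex_of_real (\<Prod>e\<leftarrow>map Re as. [:- e, 1:]) = char_poly ?C"
    unfolding as
    by (induction as)
       (simp_all add: hom_mult del: mult_pCons_left mult_pCons_right)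
  also have "\<dots> = map_poly complex_of_real (char_poly A)"
    using of_real_hom.char_poly_hom[OF Ac] by simp
  finally have "(\<Prod>e\<leftarrow>map Re as. [:- e, 1:]) = char_poly A"
    by simp
  then show ?thesis
    by metis
qed

text \<open>Deflation by induction on the roots: a reflection carrying the first unit vector to an
  eigenvector for e turns A into diag(e, B'), and the induction hypothesis handles B'. The list
  \<open>es\<close> is arbitrary so that the diagonal can be taken in the order of
  \<open>eigvals\<close>.\<close>

lemma sym_mats_diagonalizable:
  assumes "A \<in> sym_mats n" "char_poly A = (\<Prod>e\<leftarrow>es. [:- e, 1:])"
  shows "\<exists>U \<in> carrier_mat n n. transpose_mat U * U = 1\<^sub>m n \<and>
           transpose_mat U * A * U = mat_diag n (\<lambda>i. es ! i)"
  using assms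
proof (induction es arbitrary: A n)
  case Nil
  then have "n = 0"
    using degree_monic_char_poly[OF sym_matsD(1)[OF Nil(1)]] by simp
  then show ?case
    using sym_matsD(1)[OF Nil(1)]
    by (intro bexI[of _ "1\<^sub>m 0"] conjI eq_matI) (auto simp: mat_diag_def)
next
  case (Cons e es)
  note A = sym_matsD(1)[OF Cons.prems(1)]
  have "degree (char_poly A) = Suc (length es)"
    unfolding Cons.prems(2) using degree_linear_factors[of uminus "e # es"] by simp
  then obtain m where n: "n = Suc m"
    using degree_monic_char_poly[OF A] by simp
  have "eigenvalue A e"
    unfolding eigenvalue_root_char_poly[OF A] Cons.prems(2) by simp
  then obtain x where x: "x \<in> carrier_vec n" "x \<noteq> 0\<^sub>v n" "A *\<^sub>v x = e \<cdot>\<^sub>v x"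
    using A by (auto simp: eigenvalue_def eigenvector_def)
  have "x \<bullet> x > 0"
    using x(1,2) by (rule scalar_prod_self_pos)
  define v where "v = (1 / sqrt (x \<bullet> x)) \<cdot>\<^sub>v x"
  have v: "v \<in> carrier_vec n" "v \<bullet> v = 1" "A *\<^sub>v v = e \<cdot>\<^sub>v v"
    using x A \<open>x \<bullet> x > 0\<close>
    by (simp_all add: v_def mult_mat_vec[of _ n n] smult_smult_assoc mult.commute)
  obtain H where H: "H \<in> sym_mats n" "H * H = 1\<^sub>m n" "H *\<^sub>v unit_vec n 0 = v"
    using reflection_exists[OF v(1,2)] n by auto
  note Hc = sym_matsD(1)[OF H(1)]
  define B where "B = H * A * H"
  have B: "B \<in> carrier_mat n n"
    using A Hc by (simp add: B_def)
  have "transpose_mat B = transpose_mat H * (transpose_mat A * transpose_mat H)"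
    unfolding B_def using A Hc by (simp add: transpose_mult[of _ n n _ n])
  also have "\<dots> = B"
    unfolding sym_matsD(2)[OF H(1)] sym_matsD(2)[OF Cons.prems(1)] B_def using A Hc by simp
  finally have Bs: "B \<in> sym_mats n"
    using B unfolding sym_mats_def by blast
  have "H *\<^sub>v v = (H * H) *\<^sub>v unit_vec n 0"
    using Hc by (simp add: H(3)[symmetric] assoc_mult_mat_vec[of _ n n _ n])
  also have "\<dots> = unit_vec n 0"
    unfolding H(2) by simp
  finally have Hv: "H *\<^sub>v v = unit_vec n 0" .
  have "B *\<^sub>v unit_vec n 0 = H *\<^sub>v (A *\<^sub>v (H *\<^sub>v unit_vec n 0))"
    unfolding B_def using A Hc by (simp add: assoc_mult_mat_vec[of _ n n _ n])
  also have "\<dots> = e \<cdot>\<^sub>v unit_vec n 0"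
    using v Hc by (simp add: H(3) mult_mat_vec[of _ n n] Hv)
  finally have Be: "B *\<^sub>v unit_vec n 0 = e \<cdot>\<^sub>v unit_vec n 0" .
  \<comment> \<open>The first column is e times the unit vector; symmetry then clears the first row
    as well.\<close>
  have B0: "B $$ (i, 0) = (if i = 0 then e else 0)" if "i < n" for i
    using arg_cong[OF Be, of "\<lambda>z. z $ i"] that B n by auto
  define B' where "B' = mat m m (\<lambda>(i, j). B $$ (Suc i, Suc j))"
  define E where "E = mat 1 1 (\<lambda>_. e)"
  have B'c: "B' \<in> carrier_mat m m" and Ec: "E \<in> carrier_mat 1 1"
    by (simp_all add: B'_def E_def)
  have Beq: "B = four_block_mat E (0\<^sub>m 1 m) (0\<^sub>m m 1) B'"
  proof (rule eq_matI)
    fix i j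
    assume "i < dim_row (four_block_mat E (0\<^sub>m 1 m) (0\<^sub>m m 1) B')"
      and "j < dim_col (four_block_mat E (0\<^sub>m 1 m) (0\<^sub>m m 1) B')"
    then have ij: "i < n" "j < n"
      by (simp_all add: n B'_def E_def)
    then show "B $$ (i, j) = four_block_mat E (0\<^sub>m 1 m) (0\<^sub>m m 1) B' $$ (i, j)"
      using B0[of i] B0[of j] sym_mats_index[OF Bs, of 0 j]
      by (cases i; cases j) (auto simp: n E_def B'_def)
  qed (use B n in \<open>auto simp: B'_def E_def\<close>)
  have "B' \<in> sym_mats m"
    by (rule sym_matsI) (auto simp: B'_def sym_mats_index[OF Bs] n)
  have "similar_mat A B"
  proof (rule similar_matI)
    have "H * B * H = (H * H) * A * (H * H)"
      unfolding B_def using A Hc by (simp add: assoc_mult_mat[of _ n n _ n _ n])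
    then show "A = H * B * H"
      unfolding H(2) using A by simp
  qed (use A B Hc H(2) in auto)
  then have "char_poly A = char_poly B"
    by (rule char_poly_similar)
  also have "\<dots> = char_poly E * char_poly B'"
    unfolding Beq by (rule char_poly_four_block_zeros_col) (use B'c Ec in auto)
  also have "char_poly E = [:- e, 1:]"
    by (subst char_poly_upper_triangular[OF Ec]) (auto simp: E_def diag_mat_def)
  \<comment> \<open>Cancelling the common linear factor leaves B' with exactly the remaining roots,
    counted with multiplicity.\<close>
  finally have "[:- e, 1:] * char_poly B' = [:- e, 1:] * (\<Prod>e\<leftarrow>es. [:- e, 1:])"
    unfolding Cons.prems(2) list.map prod_list.Cons by (rule sym)
  then have "char_poly B' = (\<Prod>e\<leftarrow>es. [:- e, 1:])"
    by (subst (asm) mult_left_cancel) simp_all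
  from Cons.IH[OF \<open>B' \<in> sym_mats m\<close> this] obtain V where V: "V \<in> carrier_mat m m"
      "transpose_mat V * V = 1\<^sub>m m" "transpose_mat V * B' * V = mat_diag m (\<lambda>i. es ! i)"
    by auto
  \<comment> \<open>The orthogonal matrix for A is H F, where F is V bordered by 1 and G is the
    transpose of F.\<close>
  define F where "F = four_block_mat (1\<^sub>m 1) (0\<^sub>m 1 m) (0\<^sub>m m 1) V"
  define G where "G = four_block_mat (1\<^sub>m 1) (0\<^sub>m 1 m) (0\<^sub>m m 1) (transpose_mat V)"
  have F: "F \<in> carrier_mat n n" and G: "G \<in> carrier_mat n n"
    using V(1) four_block_carrier_mat[of "1\<^sub>m 1" 1 1 _ m m] by (auto simp: F_def G_def n)
  have "transpose_mat F = G"
    unfolding F_def G_def using V(1) by (subst transpose_four_block_mat[of _ 1 1 _ m _ m]) auto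
  have GF: "G * F = 1\<^sub>m n"
    unfolding F_def G_def using V(1)
    by (subst mult_four_block_mat[of _ 1 1 _ m _ m _ _ 1 _ m]) (auto simp: V(2) n)
  have "G * B * F = four_block_mat E (0\<^sub>m 1 m) (0\<^sub>m m 1) (transpose_mat V * B' * V)"
    unfolding F_def G_def Beq using V(1) Ec B'c
    by (simp add: mult_four_block_mat[of _ 1 1 _ m _ m _ _ 1 _ m])
  also have "\<dots> = mat_diag n (\<lambda>i. (e # es) ! i)"
    unfolding V(3) by (intro eq_matI) (auto simp: n mat_diag_def E_def nth_Cons')
  finally have GBF: "G * B * F = mat_diag n (\<lambda>i. (e # es) ! i)" .
  have tU: "transpose_mat (H * F) = G * H"
    unfolding transpose_mult[OF Hc F] \<open>transpose_mat F = G\<close> sym_matsD(2)[OF H(1)] ..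
  show ?case
  proof (intro bexI[of _ "H * F"] conjI)
    have "G * H * (H * F) = G * (H * H) * F"
      using F G Hc by (simp add: assoc_mult_mat[of _ n n _ n _ n])
    then show "transpose_mat (H * F) * (H * F) = 1\<^sub>m n"
      unfolding tU H(2) using G GF by simp
    have "G * H * A * (H * F) = G * B * F"
      unfolding B_def using F G Hc A by (simp add: assoc_mult_mat[of _ n n _ n _ n])
    then show "transpose_mat (H * F) * A * (H * F) = mat_diag n (\<lambda>i. (e # es) ! i)"
      unfolding tU GBF .
  qed (use F Hc in simp)
qed

text \<open>Justifies the definite description: sorting any list of roots gives existence, and the
  multiset \<open>proots\<close> together with sortedness gives uniqueness.\<close>

lemma eigvals_char_poly:
  assumes "A \<in> sym_mats n"
  shows "char_poly A = (\<Prod>e\<leftarrow>eigvals A. [:- e, 1:]) \<and> sorted_wrt (\<ge>) (eigvals A)"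
  unfolding eigvals_def
proof (rule theI')
  have roots: "proots (\<Prod>e\<leftarrow>es. [:- e, 1:]) = mset es" for es :: "real list"
  proof (induction es)
    case (Cons e es)
    have "(\<Prod>e\<leftarrow>es. [:- e, 1:]) \<noteq> 0"
      by (auto simp: prod_list_zero_iff)
    then have "proots ([:- e, 1:] * (\<Prod>e\<leftarrow>es. [:- e, 1:])) = {#e#} + mset es"
      by (subst proots_mult) (simp_all add: Cons.IH)
    then show ?case
      by (simp del: mult_pCons_left)
  qed simp
  obtain es where es: "char_poly A = (\<Prod>e\<leftarrow>es. [:- e, 1:])"
    using sym_char_poly_splits[OF assms] by blast
  show "\<exists>!fs. char_poly A = (\<Prod>e\<leftarrow>fs. [:- e, 1:]) \<and> sorted_wrt (\<ge>) fs"
  proof (rule ex1I)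
    have "prod_mset (image_mset (\<lambda>e. [:- e, 1:]) (mset (rev (sort es)))) =
        prod_mset (image_mset (\<lambda>e. [:- e, 1:]) (mset es))"
      by simp
    then have "(\<Prod>e\<leftarrow>rev (sort es). [:- e, 1:]) = (\<Prod>e\<leftarrow>es. [:- e, 1:])"
      unfolding mset_map[symmetric] prod_mset_prod_list .
    then show "char_poly A = (\<Prod>e\<leftarrow>rev (sort es). [:- e, 1:]) \<and>
        sorted_wrt (\<ge>) (rev (sort es))"
      unfolding es by (simp add: sorted_wrt_rev)
  next
    fix fs
    assume fs: "char_poly A = (\<Prod>e\<leftarrow>fs. [:- e, 1:]) \<and> sorted_wrt (\<ge>) fs"
    then have "mset (rev fs) = mset es"
      using es roots by (metis mset_rev)
    moreover have "sorted (rev fs)"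
      using fs by (simp add: sorted_wrt_rev)
    ultimately have "sort es = rev fs"
      by (rule properties_for_sort)
    then show "fs = rev (sort es)"
      by simp
  qed
qed

lemma length_eigvals:
  assumes "A \<in> sym_mats n"
  shows "length (eigvals A) = n"
  using degree_linear_factors[of uminus "eigvals A"] eigvals_char_poly[OF assms]
    degree_monic_char_poly[OF sym_matsD(1)[OF assms]]
  by simp

text \<open>The last two facts are A = sum of \<lambda>_i u_i u_i^T and I = sum of u_i u_i^T, each
  paired with an arbitrary B, which keeps sums of matrices out of the argument.\<close>

lemma sym_spectral_decomposition:
  assumes A: "A \<in> sym_mats n"
  obtains u where "\<And>i. i < n \<Longrightarrow> u i \<in> carrier_vec n" "\<And>i. i < n \<Longrightarrow> u i \<bullet> u i = 1"
    "\<And>i. i < n \<Longrightarrow> A *\<^sub>v u i = (eigvals A ! i) \<cdot>\<^sub>v u i"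
    "\<And>B. B \<in> carrier_mat n n \<Longrightarrow> mat_inner A B = (\<Sum>i<n. eigvals A ! i * (u i \<bullet> (B *\<^sub>v u i)))"
    "\<And>B. B \<in> carrier_mat n n \<Longrightarrow> mat_trace B = (\<Sum>i<n. u i \<bullet> (B *\<^sub>v u i))"
proof -
  note Ac = sym_matsD(1)[OF A]
  define d where "d = (\<lambda>i. eigvals A ! i)"
  obtain U where U: "U \<in> carrier_mat n n" "transpose_mat U * U = 1\<^sub>m n"
      "transpose_mat U * A * U = mat_diag n d"
    using sym_mats_diagonalizable[OF A conjunct1[OF eigvals_char_poly[OF A]]]
    by (auto simp: d_def)
  let ?T = "transpose_mat U"
  have T: "?T \<in> carrier_mat n n"
    using U(1) by simp
  have UT: "U * ?T = 1\<^sub>m n"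
    by (rule mat_mult_left_right_inverse[OF T U(1,2)])
  define u where "u = (\<lambda>i. col U i)"
  have u: "u i \<in> carrier_vec n" if "i < n" for i
    using U(1) that by (auto simp: u_def)
  have "U * (?T * A * U) = (U * ?T) * A * U"
    using U(1) T Ac by (simp add: assoc_mult_mat[of _ n n _ n _ n])
  then have AU: "A * U = U * mat_diag n d"
    unfolding U(3) UT using Ac by simp
  have "U * mat_diag n d * ?T = A * (U * ?T)"
    unfolding AU[symmetric] using U(1) T Ac by (simp add: assoc_mult_mat[of _ n n _ n _ n])
  then have A_eq: "U * mat_diag n d * ?T = A"
    unfolding UT using Ac by simp
  have one_eq: "U * mat_diag n (\<lambda>_. 1) * ?T = 1\<^sub>m n"
    using UT U(1) by simp
  \<comment> \<open>A general diagonal c serves twice: c = d recovers A, and c = 1 recovers the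
    identity and hence the trace.\<close>
  have inner: "mat_inner (U * mat_diag n c * ?T) B = (\<Sum>k<n. c k * (u k \<bullet> (B *\<^sub>v u k)))"
    if B: "B \<in> carrier_mat n n" for B c
  proof -
    have index: "(U * mat_diag n c * ?T) $$ (i, j) = (\<Sum>k<n. c k * (u k $ i * u k $ j))"
      if "i < n" "j < n" for i j
      unfolding mat_diag_mult_right[OF U(1)] u_def using U(1) that
      by (simp add: scalar_prod_def atLeast0LessThan mult_ac)
    have "mat_inner (U * mat_diag n c * ?T) B =
        (\<Sum>i<n. \<Sum>j<n. \<Sum>k<n. c k * (u k $ i * u k $ j) * B $$ (i, j))"
    proof -
      have "U * mat_diag n c * ?T \<in> carrier_mat n n"
        by (rule mult_carrier_mat[OF mult_carrier_mat[OF U(1) mat_diag_dim] T])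
      from mat_inner_eq_sum[OF this B] show ?thesis
        unfolding sum_distrib_right[symmetric]
        by (elim trans) (intro sum.cong refl, simp only: index lessThan_iff)
    qed
    also have "\<dots> = (\<Sum>i<n. \<Sum>k<n. \<Sum>j<n. c k * (u k $ i * u k $ j) * B $$ (i, j))"
      by (intro sum.cong refl sum.swap)
    also have "\<dots> = (\<Sum>k<n. \<Sum>i<n. \<Sum>j<n. c k * (u k $ i * u k $ j) * B $$ (i, j))"
      by (rule sum.swap)
    also have "\<dots> = (\<Sum>k<n. c k * mat_inner (outer (u k)) B)"
      using u B U(1)
      by (intro sum.cong refl)
         (simp add: mat_inner_eq_sum[of _ n] outer_def u_def sum_distrib_left mult_ac)
    also have "\<dots> = (\<Sum>k<n. c k * (u k \<bullet> (B *\<^sub>v u k)))"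
      using u B by (intro sum.cong refl) (simp add: mat_inner_outer[of _ n])
    finally show ?thesis .
  qed
  show ?thesis
  proof (rule that[OF u])
    fix i assume i: "i < n"
    have "u i \<bullet> u i = (?T * U) $$ (i, i)"
      using i U(1) by (simp add: u_def)
    then show "u i \<bullet> u i = 1"
      unfolding U(2) using i by simp
    have "A *\<^sub>v u i = col (A * U) i"
      using i U(1) Ac by (intro eq_vecI) (auto simp: u_def)
    also have "\<dots> = d i \<cdot>\<^sub>v u i"
      unfolding AU mat_diag_mult_right[OF U(1)] u_def using i U(1) by (intro eq_vecI) auto
    finally show "A *\<^sub>v u i = (eigvals A ! i) \<cdot>\<^sub>v u i"
      by (simp add: d_def)
  next
    fix B :: "real mat" assume B: "B \<in> carrier_mat n n"
    show "mat_inner A B = (\<Sum>i<n. eigvals A ! i * (u i \<bullet> (B *\<^sub>v u i)))"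
      using inner[OF B, of d] unfolding A_eq by (simp add: d_def)
    have "mat_trace B = mat_inner (1\<^sub>m n) B"
      using B by (simp add: mat_inner_def)
    then show "mat_trace B = (\<Sum>i<n. u i \<bullet> (B *\<^sub>v u i))"
      using inner[OF B, of "\<lambda>_. 1"] unfolding one_eq by simp
  qed
qed

section \<open>Extreme eigenvalues and the spectral gap as bounds on quadratic forms\<close>

lemma quadratic_form_le_eigval_1:
  assumes A: "A \<in> sym_mats n" and y: "y \<in> carrier_vec n"
  shows "y \<bullet> (A *\<^sub>v y) \<le> eigval A 1 * (y \<bullet> y)"
proof -
  obtain u where u: "\<And>i. i < n \<Longrightarrow> u i \<in> carrier_vec n"
    "\<And>B. B \<in> carrier_mat n n \<Longrightarrow> mat_inner A B = (\<Sum>i<n. eigvals A ! i * (u i \<bullet> (B *\<^sub>v u i)))"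
    "\<And>B. B \<in> carrier_mat n n \<Longrightarrow> mat_trace B = (\<Sum>i<n. u i \<bullet> (B *\<^sub>v u i))"
    by (rule sym_spectral_decomposition[OF A]) blast
  note Y = sym_matsD(1)[OF outer_sym_mats[OF y]]
  \<comment> \<open>Testing against \<open>outer y\<close> turns the decomposition of A into the
    quadratic form at y, and the trace formula into Parseval's identity for y.\<close>
  have form: "u i \<bullet> (outer y *\<^sub>v u i) = (u i \<bullet> y)\<^sup>2" if "i < n" for i
    using mat_inner_outer_outer[OF u(1)[OF that] y] mat_inner_outer[OF u(1)[OF that] Y] by simp
  have max: "eigvals A ! i \<le> eigval A 1" if "i < n" for i
    using sorted_wrt_nth_less[OF conjunct2[OF eigvals_char_poly[OF A]], of 0 i] that
      length_eigvals[OF A]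
    by (cases "i = 0") (auto simp: eigval_def)
  have "y \<bullet> (A *\<^sub>v y) = mat_inner A (outer y)"
    using mat_inner_commute[OF Y sym_matsD(1)[OF A]] mat_inner_outer[OF y sym_matsD(1)[OF A]]
    by simp
  also have "\<dots> = (\<Sum>i<n. eigvals A ! i * (u i \<bullet> y)\<^sup>2)"
    unfolding u(2)[OF Y] by (intro sum.cong) (auto simp: form)
  also have "\<dots> \<le> (\<Sum>i<n. eigval A 1 * (u i \<bullet> y)\<^sup>2)"
    by (intro sum_mono mult_right_mono max) auto
  also have "\<dots> = eigval A 1 * mat_trace (outer y)"
    unfolding u(3)[OF Y] sum_distrib_left by (intro sum.cong) (auto simp: form)
  finally show ?thesis
    by (simp add: mat_trace_outer)
qed

text \<open>
  The spectral gap enters the whole argument only through a quadratic lower bound of this shape: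
  \<open>G - c I - \<delta> (I - x x\<^sup>T)\<close> is positive semidefinite and \<open>x\<close> attains the bottom value \<open>c\<close>.
\<close>

definition gap_form :: "nat \<Rightarrow> real mat \<Rightarrow> real vec \<Rightarrow> real \<Rightarrow> real \<Rightarrow> bool" where
  "gap_form n G x c \<delta> \<longleftrightarrow> x \<in> carrier_vec n \<and> x \<bullet> x = 1 \<and> x \<bullet> (G *\<^sub>v x) = c \<and>
     (\<forall>y \<in> carrier_vec n. c * (y \<bullet> y) + \<delta> * (y \<bullet> y - (x \<bullet> y)\<^sup>2) \<le> y \<bullet> (G *\<^sub>v y))"

text \<open>Take for x the eigenvector of the last entry of \<open>eigvals\<close>. In the
  eigenbasis the lower bound puts weight c + \<delta> on every other coordinate, and the eigenvalues
  there are at least \<lambda>_(n-1) = c + \<delta>.\<close>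

lemma eigval_gap_form:
  assumes G: "G \<in> sym_mats n" and n: "2 \<le> n"
  obtains x where "gap_form n G x (eigval G n) (eigval G (n - 1) - eigval G n)"
proof -
  obtain u where u: "\<And>i. i < n \<Longrightarrow> u i \<in> carrier_vec n" "\<And>i. i < n \<Longrightarrow> u i \<bullet> u i = 1"
    "\<And>i. i < n \<Longrightarrow> G *\<^sub>v u i = (eigvals G ! i) \<cdot>\<^sub>v u i"
    "\<And>B. B \<in> carrier_mat n n \<Longrightarrow> mat_inner G B = (\<Sum>i<n. eigvals G ! i * (u i \<bullet> (B *\<^sub>v u i)))"
    "\<And>B. B \<in> carrier_mat n n \<Longrightarrow> mat_trace B = (\<Sum>i<n. u i \<bullet> (B *\<^sub>v u i))"
    by (rule sym_spectral_decomposition[OF G]) blast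
  define m where "m = n - 1"
  define c where "c = eigval G n"
  define \<delta> where "\<delta> = eigval G (n - 1) - c"
  define x where "x = u m"
  have m: "m < n" "n = Suc m"
    using n by (auto simp: m_def)
  have x: "x \<in> carrier_vec n" "x \<bullet> x = 1" "x \<bullet> (G *\<^sub>v x) = c"
    using u(1-3)[OF m(1)] by (simp_all add: x_def c_def eigval_def m_def)
  have gap: "c + \<delta> \<le> eigvals G ! i" if "i < m" for i
    using sorted_wrt_nth_less[OF conjunct2[OF eigvals_char_poly[OF G]], of i "m - 1"] that
      length_eigvals[OF G] m n
    by (cases "i = m - 1") (auto simp: eigval_def \<delta>_def)
  have "c * (y \<bullet> y) + \<delta> * (y \<bullet> y - (x \<bullet> y)\<^sup>2) \<le> y \<bullet> (G *\<^sub>v y)" if y: "y \<in> carrier_vec n" for y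
  proof -
    note Y = sym_matsD(1)[OF outer_sym_mats[OF y]]
    have form: "u i \<bullet> (outer y *\<^sub>v u i) = (u i \<bullet> y)\<^sup>2" if "i < n" for i
      using mat_inner_outer_outer[OF u(1)[OF that] y] mat_inner_outer[OF u(1)[OF that] Y] by simp
    have yy: "y \<bullet> y = (\<Sum>i<n. (u i \<bullet> y)\<^sup>2)"
      unfolding mat_trace_outer[symmetric] u(5)[OF Y] by (intro sum.cong) (auto simp: form)
    have "c * (y \<bullet> y) + \<delta> * (y \<bullet> y - (x \<bullet> y)\<^sup>2) =
        (\<Sum>i<m. (c + \<delta>) * (u i \<bullet> y)\<^sup>2) + c * (x \<bullet> y)\<^sup>2"
      unfolding yy m(2) by (simp add: x_def algebra_simps sum.distrib flip: sum_distrib_left)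
    also have "\<dots> \<le> (\<Sum>i<m. eigvals G ! i * (u i \<bullet> y)\<^sup>2) + eigvals G ! m * (x \<bullet> y)\<^sup>2"
      using gap by (intro add_mono sum_mono mult_right_mono) (auto simp: c_def eigval_def m_def)
    also have "\<dots> = (\<Sum>i<n. eigvals G ! i * (u i \<bullet> y)\<^sup>2)"
      unfolding m(2) by (simp add: x_def)
    also have "\<dots> = mat_inner G (outer y)"
      unfolding u(4)[OF Y] by (intro sum.cong) (auto simp: form)
    also have "\<dots> = y \<bullet> (G *\<^sub>v y)"
      using mat_inner_commute[OF Y sym_matsD(1)[OF G]] mat_inner_outer[OF y sym_matsD(1)[OF G]]
      by simp
    finally show ?thesis .
  qed
  then have "gap_form n G x c \<delta>"
    using x by (simp add: gap_form_def)
  then show ?thesis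
    using that by (simp add: c_def \<delta>_def)
qed

text \<open>Since \<mu> \<le> c + \<delta>/6, the vector v is nearly parallel to x, so a vector w
  orthogonal to v is nearly orthogonal to x and still feels the gap of G. The cost is \<delta>/3 for
  the misalignment, \<delta>/6 for perturbing the form at w and \<delta>/6 for the excess of \<mu>
  over c, which leaves \<delta>/3.\<close>

lemma gap_form_perturb:
  assumes G: "G \<in> sym_mats n" and G': "G' \<in> sym_mats n"
    and gap: "gap_form n G x c \<delta>" and \<delta>: "\<delta> \<ge> 0"
    and v: "v \<in> carrier_vec n" "v \<bullet> v = 1" "G' *\<^sub>v v = \<mu> \<cdot>\<^sub>v v"
    and min: "\<And>y. y \<in> carrier_vec n \<Longrightarrow> \<mu> * (y \<bullet> y) \<le> y \<bullet> (G' *\<^sub>v y)"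
    and close: "fro_norm (G' - G) \<le> \<delta> / 6"
  shows "gap_form n G' v \<mu> (\<delta> / 3)"
proof -
  note Gc = sym_matsD(1)[OF G] and Gc' = sym_matsD(1)[OF G']
  have x: "x \<in> carrier_vec n" "x \<bullet> x = 1" "x \<bullet> (G *\<^sub>v x) = c"
    and low: "\<And>y. y \<in> carrier_vec n \<Longrightarrow>
      c * (y \<bullet> y) + \<delta> * (y \<bullet> y - (x \<bullet> y)\<^sup>2) \<le> y \<bullet> (G *\<^sub>v y)"
    using gap by (auto simp: gap_form_def)
  have vGv: "v \<bullet> (G' *\<^sub>v v) = \<mu>"
    using v by simp
  \<comment> \<open>The Frobenius norm of \<open>outer y\<close> is y . y, so Cauchy-Schwarz
    controls the change of the quadratic form.\<close>
  have diff: "\<bar>y \<bullet> (G' *\<^sub>v y) - y \<bullet> (G *\<^sub>v y)\<bar> \<le> \<delta> / 6 * (y \<bullet> y)" if y: "y \<in> carrier_vec n" for y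
  proof -
    note Y = sym_matsD(1)[OF outer_sym_mats[OF y]]
    have yy: "y \<bullet> y \<ge> 0"
      using y by (simp add: scalar_prod_def sum_nonneg)
    have "y \<bullet> (G' *\<^sub>v y) - y \<bullet> (G *\<^sub>v y) = mat_inner (outer y) (G' - G)"
      using y Y Gc Gc' by (simp add: mat_inner_linear[of _ n] mat_inner_outer[of _ n])
    also have "\<bar>\<dots>\<bar> \<le> fro_norm (outer y) * fro_norm (G' - G)"
      using Y Gc Gc' by (intro mat_inner_Cauchy_Schwarz) auto
    also have "fro_norm (outer y) = y \<bullet> y"
      using yy y by (simp add: fro_norm_def mat_inner_outer_outer[of _ n])
    also have "y \<bullet> y * fro_norm (G' - G) \<le> y \<bullet> y * (\<delta> / 6)"
      using yy close by (intro mult_left_mono)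
    finally show ?thesis
      by (simp add: mult.commute)
  qed
  have "\<mu> * (y \<bullet> y) + \<delta> / 3 * (y \<bullet> y - (v \<bullet> y)\<^sup>2) \<le> y \<bullet> (G' *\<^sub>v y)"
    if y: "y \<in> carrier_vec n" for y
  proof -
    \<comment> \<open>Split y = a v + w with w orthogonal to v. As v is an eigenvector of the
      symmetric G', the form has no cross terms and only its value at w needs a bound.\<close>
    define a where "a = v \<bullet> y"
    define w where "w = y - a \<cdot>\<^sub>v v"
    define r where "r = w \<bullet> w"
    have w: "w \<in> carrier_vec n"
      using y v by (simp add: w_def)
    note sp = minus_scalar_prod_distrib[of _ n] scalar_prod_minus_distrib[of _ n]
    have yv: "y \<bullet> v = a"
      using comm_scalar_prod[OF y v(1)] by (simp add: a_def)
    have vw: "v \<bullet> w = 0"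
      using y v by (simp add: w_def sp a_def)
    have r: "r = y \<bullet> y - a\<^sup>2"
      unfolding r_def w_def using y v yv
      by (simp add: sp power2_eq_square flip: a_def)
    have "v \<bullet> (G' *\<^sub>v y) = y \<bullet> (G' *\<^sub>v v)"
      by (rule sym_mats_scalar_prod[OF G' v(1) y])
    also have "\<dots> = \<mu> * a"
      using y v yv by simp
    finally have vGy: "v \<bullet> (G' *\<^sub>v y) = \<mu> * a" .
    have Gw: "G' *\<^sub>v w = G' *\<^sub>v y - (a * \<mu>) \<cdot>\<^sub>v v"
      using y v Gc'
      by (simp add: w_def mult_minus_distrib_mat_vec[of _ n n] mult_mat_vec[of _ n n] smult_smult_assoc)
    have wGw: "w \<bullet> (G' *\<^sub>v w) = y \<bullet> (G' *\<^sub>v y) - \<mu> * a\<^sup>2"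
      unfolding Gw using y v Gc' w vw yv comm_scalar_prod[OF w v(1)]
      by (simp add: sp w_def vGy power2_eq_square)
    have "w \<bullet> (G' *\<^sub>v w) \<ge> (\<mu> + \<delta> / 3) * r"
    proof (cases "r = 0")
      case True
      then show ?thesis
        using min[OF w] by (simp add: r_def)
    next
      case False
      define p where "p = x \<bullet> w"
      define q where "q = x \<bullet> v"
      have "r > 0"
        using False w by (simp add: r_def scalar_prod_def sum_nonneg less_le)
      \<comment> \<open>z is r times the component of x orthogonal to both w and v; its norm being
        nonnegative is Bessel's inequality.\<close>
      define z where "z = r \<cdot>\<^sub>v x - (p \<cdot>\<^sub>v w + (r * q) \<cdot>\<^sub>v v)"
      have "0 \<le> z \<bullet> z"
        by (simp add: scalar_prod_def sum_nonneg)
      also have "z \<bullet> z = r * (r - p\<^sup>2 - r * q\<^sup>2)"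
        unfolding z_def using x v w vw comm_scalar_prod[OF w v(1)] comm_scalar_prod[OF w x(1)]
          comm_scalar_prod[OF v(1) x(1)]
        by (simp add: sp add_scalar_prod_distrib[of _ n] scalar_prod_add_distrib[of _ n]
            p_def[symmetric] q_def[symmetric] r_def[symmetric] power2_eq_square algebra_simps)
      finally have bessel: "p\<^sup>2 + r * q\<^sup>2 \<le> r"
        using \<open>r > 0\<close> by (simp add: zero_le_mult_iff)
      have 1: "w \<bullet> (G' *\<^sub>v w) \<ge> c * r + \<delta> * (r - p\<^sup>2) - \<delta> / 6 * r"
        using low[OF w] diff[OF w] unfolding r_def p_def by linarith
      have 2: "\<mu> \<ge> c + \<delta> * (1 - q\<^sup>2) - \<delta> / 6"
        using low[OF v(1)] diff[OF v(1)] unfolding vGv v(2) q_def by linarith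
      have 3: "\<mu> \<le> c + \<delta> / 6"
        using min[OF x(1)] diff[OF x(1)] unfolding x(2,3) by linarith
      \<comment> \<open>Facts 2 and 3 give \<delta> (1 - q^2) \<le> \<delta>/3, hence \<delta> p^2
        \<le> r \<delta>/3 by Bessel. Scaling by r first leaves only linear arithmetic.\<close>
      have "r * (c + \<delta> * (1 - q\<^sup>2) - \<delta> / 6) \<le> r * \<mu>"
        using 2 \<open>r > 0\<close> by (intro mult_left_mono) auto
      moreover have "r * \<mu> \<le> r * (c + \<delta> / 6)"
        using 3 \<open>r > 0\<close> by (intro mult_left_mono) auto
      moreover have "\<delta> * (p\<^sup>2 + r * q\<^sup>2) \<le> \<delta> * r"
        using bessel \<delta> by (intro mult_left_mono)
      ultimately show ?thesis
        using 1 by (simp add: algebra_simps)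
    qed
    then show ?thesis
      unfolding wGw r a_def by (simp add: algebra_simps)
  qed
  then show ?thesis
    using v vGv by (simp add: gap_form_def)
qed

section \<open>The spectrahedron\<close>

lemma spectrahedron_sym: "X \<in> spectrahedron n \<Longrightarrow> X \<in> sym_mats n"
  by (simp add: spectrahedron_def psd_def)

lemma mat_trace_add_smult:
  assumes "X \<in> carrier_mat n n" "Y \<in> carrier_mat n n"
  shows "mat_trace (a \<cdot>\<^sub>m X + b \<cdot>\<^sub>m Y) = a * mat_trace X + b * mat_trace Y"
  using assms
  by (simp add: mat_trace_def diag_mat_def sum_list_sum_nth sum.distrib sum_distrib_left)

lemma spectrahedron_convex:
  assumes X: "X \<in> spectrahedron n" and Y: "Y \<in> spectrahedron n" and s: "s \<in> {0..1}"
  shows "(1 - s) \<cdot>\<^sub>m X + s \<cdot>\<^sub>m Y \<in> spectrahedron n"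
proof -
  note sym = spectrahedron_sym[OF X] spectrahedron_sym[OF Y]
  note c = sym[THEN sym_matsD(1)]
  let ?Z = "(1 - s) \<cdot>\<^sub>m X + s \<cdot>\<^sub>m Y"
  have Z: "?Z \<in> sym_mats n"
    using sym by blast
  have "u \<bullet> (?Z *\<^sub>v u) \<ge> 0" if u: "u \<in> carrier_vec n" for u
  proof -
    note U = sym_matsD(1)[OF outer_sym_mats[OF u]]
    have "u \<bullet> (?Z *\<^sub>v u) = mat_inner (outer u) ?Z"
      using u sym_matsD(1)[OF Z] by (simp add: mat_inner_outer)
    also have "\<dots> = (1 - s) * (u \<bullet> (X *\<^sub>v u)) + s * (u \<bullet> (Y *\<^sub>v u))"
      using c U u by (simp add: mat_inner_linear[of _ n] mat_inner_outer[of _ n])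
    also have "\<dots> \<ge> 0"
      using X Y s u by (simp add: spectrahedron_def psd_def)
    finally show ?thesis .
  qed
  moreover have "mat_trace ?Z = 1"
    using X Y c by (simp add: mat_trace_add_smult[of _ n] spectrahedron_def)
  ultimately show ?thesis
    using Z by (simp add: spectrahedron_def psd_def)
qed

lemma outer_spectrahedron:
  assumes v: "v \<in> carrier_vec n" "v \<bullet> v = 1"
  shows "outer v \<in> spectrahedron n"
proof -
  have "u \<bullet> (outer v *\<^sub>v u) \<ge> 0" if "u \<in> carrier_vec n" for u
    using that v(1) comm_scalar_prod[OF that v(1)] by (simp add: outer_mult_vec[of _ n])
  then show ?thesis
    using v by (simp add: spectrahedron_def psd_def mat_trace_outer)
qed

text \<open>Semidefiniteness makes the eigenvalues nonnegative and the trace makes them sum to 1, so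
  X is a convex combination of rank-one projections.\<close>

lemma spectrahedron_decomposition:
  assumes X: "X \<in> spectrahedron n"
  obtains u \<sigma> where "\<And>i. i < n \<Longrightarrow> u i \<in> carrier_vec n" "\<And>i. i < n \<Longrightarrow> u i \<bullet> u i = 1"
    "\<And>i. i < n \<Longrightarrow> u i \<bullet> (X *\<^sub>v u i) = \<sigma> i" "\<And>i. i < n \<Longrightarrow> \<sigma> i \<ge> 0" "(\<Sum>i<n. \<sigma> i) = (1 :: real)"
    "\<And>B. B \<in> carrier_mat n n \<Longrightarrow> mat_inner X B = (\<Sum>i<n. \<sigma> i * (u i \<bullet> (B *\<^sub>v u i)))"
proof -
  note sym = spectrahedron_sym[OF X]
  obtain u where u: "\<And>i. i < n \<Longrightarrow> u i \<in> carrier_vec n" "\<And>i. i < n \<Longrightarrow> u i \<bullet> u i = 1"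
    "\<And>i. i < n \<Longrightarrow> X *\<^sub>v u i = (eigvals X ! i) \<cdot>\<^sub>v u i"
    "\<And>B. B \<in> carrier_mat n n \<Longrightarrow> mat_inner X B = (\<Sum>i<n. eigvals X ! i * (u i \<bullet> (B *\<^sub>v u i)))"
    "\<And>B. B \<in> carrier_mat n n \<Longrightarrow> mat_trace B = (\<Sum>i<n. u i \<bullet> (B *\<^sub>v u i))"
    by (rule sym_spectral_decomposition[OF sym]) blast
  have ux: "u i \<bullet> (X *\<^sub>v u i) = eigvals X ! i" if "i < n" for i
    using u(1-3)[OF that] by simp
  show ?thesis
  proof (rule that[of u "\<lambda>i. eigvals X ! i", OF u(1,2) ux _ _ u(4)])
    show "eigvals X ! i \<ge> 0" if "i < n" for i
      using X u(1)[OF that] ux[OF that] by (auto simp: spectrahedron_def psd_def)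
    have "mat_trace X = 1"
      using X by (simp add: spectrahedron_def)
    then show "(\<Sum>i<n. eigvals X ! i) = 1"
      unfolding u(5)[OF sym_matsD(1)[OF sym]] by (simp add: ux)
  qed
qed

text \<open>An average of values on unit vectors inherits their lower bound. This reduces linear
  minimization over the spectrahedron to a bound on a quadratic form.\<close>

lemma spectrahedron_mat_inner_ge:
  assumes X: "X \<in> spectrahedron n" and B: "B \<in> carrier_mat n n"
    and low: "\<And>y. y \<in> carrier_vec n \<Longrightarrow> y \<bullet> y = 1 \<Longrightarrow> c \<le> y \<bullet> (B *\<^sub>v y)"
  shows "c \<le> mat_inner X B"
proof -
  obtain u \<sigma> where u: "\<And>i. i < n \<Longrightarrow> u i \<in> carrier_vec n" "\<And>i. i < n \<Longrightarrow> u i \<bullet> u i = 1"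
    "\<And>i. i < n \<Longrightarrow> \<sigma> i \<ge> 0" "(\<Sum>i<n. \<sigma> i) = 1"
    "\<And>B. B \<in> carrier_mat n n \<Longrightarrow> mat_inner X B = (\<Sum>i<n. \<sigma> i * (u i \<bullet> (B *\<^sub>v u i)))"
    by (rule spectrahedron_decomposition[OF X]) blast
  have "c = (\<Sum>i<n. \<sigma> i * c)"
    using u(4) by (simp flip: sum_distrib_right)
  also have "\<dots> \<le> (\<Sum>i<n. \<sigma> i * (u i \<bullet> (B *\<^sub>v u i)))"
    using u low by (intro sum_mono mult_left_mono) auto
  finally show ?thesis
    by (simp add: u(5)[OF B])
qed

text \<open>The weights lie in [0, 1], so their squares sum to at most their sum.\<close>

lemma spectrahedron_mat_inner_self_le:
  assumes X: "X \<in> spectrahedron n"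
  shows "mat_inner X X \<le> 1"
proof -
  obtain u \<sigma> where u: "\<And>i. i < n \<Longrightarrow> u i \<bullet> (X *\<^sub>v u i) = \<sigma> i"
    "\<And>i. i < n \<Longrightarrow> \<sigma> i \<ge> 0" "(\<Sum>i<n. \<sigma> i) = 1"
    "\<And>B. B \<in> carrier_mat n n \<Longrightarrow> mat_inner X B = (\<Sum>i<n. \<sigma> i * (u i \<bullet> (B *\<^sub>v u i)))"
    by (rule spectrahedron_decomposition[OF X]) blast
  have "\<sigma> i \<le> 1" if "i < n" for i
    using member_le_sum[of i "{..<n}" \<sigma>] that u(2,3) by simp
  then have "(\<Sum>i<n. \<sigma> i * \<sigma> i) \<le> (\<Sum>i<n. \<sigma> i * 1)"
    using u(2) by (intro sum_mono mult_left_mono) auto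
  then show ?thesis
    using u(1,3) by (simp add: u(4)[OF sym_matsD(1)[OF spectrahedron_sym[OF X]]])
qed

text \<open>The inner product of two semidefinite matrices is nonnegative, so dropping the cross
  term leaves at most 1 + 1.\<close>

lemma spectrahedron_diameter:
  assumes X: "X \<in> spectrahedron n" and Y: "Y \<in> spectrahedron n"
  shows "(fro_norm (X - Y))\<^sup>2 \<le> 2"
proof -
  note c = sym_matsD(1)[OF spectrahedron_sym[OF X]] sym_matsD(1)[OF spectrahedron_sym[OF Y]]
  have "0 \<le> mat_inner X Y"
    using Y by (intro spectrahedron_mat_inner_ge[OF X c(2)]) (auto simp: spectrahedron_def psd_def)
  then show ?thesis
    using spectrahedron_mat_inner_self_le[OF X] spectrahedron_mat_inner_self_le[OF Y]
    by (simp add: fro_norm_diff_power2[OF c])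
qed

text \<open>For unit y the gap says that the form of G + \<delta> x x^T is at least c + \<delta>;
  averaging gives \<open>mat_inner X G\<close> - c at least \<delta> (1 -
  \<open>mat_inner X (outer x)\<close>). The factor 1/2 arises because the squared distance is at
  most twice that last bracket.\<close>

lemma gap_form_growth:
  assumes X: "X \<in> spectrahedron n" and G: "G \<in> sym_mats n"
    and gap: "gap_form n G x c \<delta>" and \<delta>: "\<delta> \<ge> 0"
  shows "\<delta> / 2 * (fro_norm (X - outer x))\<^sup>2 \<le> mat_inner (X - outer x) G"
proof -
  have x: "x \<in> carrier_vec n" "x \<bullet> x = 1" "x \<bullet> (G *\<^sub>v x) = c"
    and low: "\<And>y. y \<in> carrier_vec n \<Longrightarrow>
      c * (y \<bullet> y) + \<delta> * (y \<bullet> y - (x \<bullet> y)\<^sup>2) \<le> y \<bullet> (G *\<^sub>v y)"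
    using gap by (auto simp: gap_form_def)
  note Xc = sym_matsD(1)[OF spectrahedron_sym[OF X]] and Gc = sym_matsD(1)[OF G]
    and V = sym_matsD(1)[OF outer_sym_mats[OF x(1)]]
  have "c + \<delta> \<le> mat_inner X (G + \<delta> \<cdot>\<^sub>m outer x)"
  proof (rule spectrahedron_mat_inner_ge[OF X])
    fix y :: "real vec" assume y: "y \<in> carrier_vec n" "y \<bullet> y = 1"
    note Y = sym_matsD(1)[OF outer_sym_mats[OF y(1)]]
    have "y \<bullet> ((G + \<delta> \<cdot>\<^sub>m outer x) *\<^sub>v y) = mat_inner (outer y) (G + \<delta> \<cdot>\<^sub>m outer x)"
      using y Gc V by (simp add: mat_inner_outer[of _ n])
    also have "\<dots> = y \<bullet> (G *\<^sub>v y) + \<delta> * (x \<bullet> y)\<^sup>2"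
      using y x Y V Gc comm_scalar_prod[OF y(1) x(1)]
      by (simp add: mat_inner_add_right[of _ n] mat_inner_smult_right[of _ n]
          mat_inner_outer_outer[of _ n]) (simp add: mat_inner_outer[of _ n])
    finally show "c + \<delta> \<le> y \<bullet> ((G + \<delta> \<cdot>\<^sub>m outer x) *\<^sub>v y)"
      using low[OF y(1)] y(2) by (simp add: algebra_simps)
  qed (use Gc V in simp)
  then have "\<delta> * (1 - mat_inner X (outer x)) \<le> mat_inner X G - c"
    using Xc Gc V by (simp add: mat_inner_linear[of _ n] algebra_simps)
  moreover have "\<delta> * (fro_norm (X - outer x))\<^sup>2 \<le> \<delta> * (2 - 2 * mat_inner X (outer x))"
    using spectrahedron_mat_inner_self_le[OF X] x \<delta>
    by (intro mult_left_mono)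
       (simp_all add: fro_norm_diff_power2[OF Xc V] mat_inner_outer_outer[of _ n])
  moreover have "mat_inner (X - outer x) G = mat_inner X G - c"
    using Xc Gc V x by (simp add: mat_inner_linear[of _ n] mat_inner_outer[of _ n])
  ultimately show ?thesis
    by (simp add: algebra_simps)
qed

section \<open>Gradients of smooth convex functions\<close>

lemma add_smult_minus_self:
  assumes "X \<in> carrier_mat n n" "D \<in> carrier_mat n n"
  shows "X + c \<cdot>\<^sub>m D - X = c \<cdot>\<^sub>m (D :: real mat)"
  using assms by (intro eq_matI) auto

lemma convex_combination_eq:
  assumes "X \<in> carrier_mat n n" "Y \<in> carrier_mat n n"
  shows "(1 - s) \<cdot>\<^sub>m X + s \<cdot>\<^sub>m Y = X + s \<cdot>\<^sub>m (Y - X :: real mat)"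
  using assms by (intro eq_matI) (auto simp: algebra_simps)

lemma has_gradient_sym: "has_gradient n f X G \<Longrightarrow> G \<in> sym_mats n"
  by (simp add: has_gradient_def)

lemma has_gradientD:
  assumes "has_gradient n f X G" "X \<in> sym_mats n" "D \<in> sym_mats n" "\<epsilon> > 0"
  obtains r where "r > 0"
    "\<And>s. \<bar>s\<bar> < r \<Longrightarrow> \<bar>f (X + s \<cdot>\<^sub>m D) - f X - s * mat_inner G D\<bar> \<le> \<epsilon> * \<bar>s\<bar>"
proof -
  define N where "N = fro_norm D"
  note Xc = sym_matsD(1)[OF assms(2)] and Dc = sym_matsD(1)[OF assms(3)]
    and Gc = sym_matsD(1)[OF has_gradient_sym[OF assms(1)]]
  have N: "N \<ge> 0"
    using fro_norm_nonneg[OF Dc] by (simp add: N_def)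
  \<comment> \<open>The denominator N + 1 in place of N covers D = 0.\<close>
  then have "\<epsilon> / (N + 1) > 0"
    using assms(4) by simp
  then obtain d where d: "d > 0" "\<And>Y. Y \<in> sym_mats n \<Longrightarrow> fro_norm (Y - X) < d \<Longrightarrow>
      \<bar>f Y - f X - mat_inner G (Y - X)\<bar> \<le> \<epsilon> / (N + 1) * fro_norm (Y - X)"
    using assms(1) unfolding has_gradient_def by blast
  show ?thesis
  proof (rule that[of "d / (N + 1)"])
    show "d / (N + 1) > 0"
      using d(1) N by simp
  next
    fix s :: real assume s: "\<bar>s\<bar> < d / (N + 1)"
    have "\<bar>s\<bar> * N \<le> \<bar>s\<bar> * (N + 1)"
      by (simp add: mult_left_mono)
    also have "\<dots> < d"
      using s N by (simp add: field_simps)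
    finally have "fro_norm (X + s \<cdot>\<^sub>m D - X) < d"
      unfolding add_smult_minus_self[OF Xc Dc] fro_norm_smult[OF Dc] N_def .
    from d(2)[OF _ this] have
      "\<bar>f (X + s \<cdot>\<^sub>m D) - f X - mat_inner G (s \<cdot>\<^sub>m D)\<bar> \<le> \<epsilon> / (N + 1) * (\<bar>s\<bar> * N)"
      unfolding add_smult_minus_self[OF Xc Dc] fro_norm_smult[OF Dc] N_def
      using assms(2,3) by blast
    also have "\<dots> = \<epsilon> * \<bar>s\<bar> * (N / (N + 1))"
      by simp
    also have "\<dots> \<le> \<epsilon> * \<bar>s\<bar> * 1"
      using N assms(4) by (intro mult_left_mono) auto
    finally show "\<bar>f (X + s \<cdot>\<^sub>m D) - f X - s * mat_inner G D\<bar> \<le> \<epsilon> * \<bar>s\<bar>"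
      using Gc Dc by (simp add: mat_inner_smult_right[of _ n])
  qed
qed

text \<open>Restriction to lines makes one-variable calculus available, both for uniqueness of the
  gradient and for the descent inequality.\<close>

lemma has_gradient_DERIV:
  assumes G: "has_gradient n f (X + s \<cdot>\<^sub>m D) G" and X: "X \<in> sym_mats n" and D: "D \<in> sym_mats n"
  shows "((\<lambda>s. f (X + s \<cdot>\<^sub>m D)) has_real_derivative mat_inner G D) (at s)"
  unfolding DERIV_def LIM_eq
proof (intro allI impI)
  fix r :: real assume r: "0 < r"
  note Xc = sym_matsD(1)[OF X] and Dc = sym_matsD(1)[OF D]
  have shift: "X + s \<cdot>\<^sub>m D + h \<cdot>\<^sub>m D = X + (s + h) \<cdot>\<^sub>m D" for h
    using Xc Dc by (intro eq_matI) (auto simp: algebra_simps)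
  obtain d where d: "d > 0" "\<And>h. \<bar>h\<bar> < d \<Longrightarrow>
      \<bar>f (X + s \<cdot>\<^sub>m D + h \<cdot>\<^sub>m D) - f (X + s \<cdot>\<^sub>m D) - h * mat_inner G D\<bar> \<le> r / 2 * \<bar>h\<bar>"
    using has_gradientD[OF G _ D, of "r / 2"] X D r by auto
  show "\<exists>d>0. \<forall>h. h \<noteq> 0 \<and> norm (h - 0) < d \<longrightarrow>
      norm ((f (X + (s + h) \<cdot>\<^sub>m D) - f (X + s \<cdot>\<^sub>m D)) / h - mat_inner G D) < r"
  proof (intro exI[of _ d] conjI allI impI)
    fix h :: real assume h: "h \<noteq> 0 \<and> norm (h - 0) < d"
    let ?a = "f (X + (s + h) \<cdot>\<^sub>m D) - f (X + s \<cdot>\<^sub>m D)"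
    have "?a / h - mat_inner G D = (?a - h * mat_inner G D) / h"
      using h by (simp add: field_simps)
    then have "\<bar>?a / h - mat_inner G D\<bar> = \<bar>?a - h * mat_inner G D\<bar> / \<bar>h\<bar>"
      by simp
    also have "\<dots> \<le> r / 2"
      using d(2)[of h] h unfolding shift by (simp add: pos_divide_le_eq)
    finally show "norm (?a / h - mat_inner G D) < r"
      using r by simp
  qed (rule d(1))
qed

text \<open>Both candidates give the same derivative along G - G', itself a symmetric direction, so
  G - G' is orthogonal to itself.\<close>

lemma has_gradient_unique:
  assumes G: "has_gradient n f X G" and G': "has_gradient n f X G'" and X: "X \<in> sym_mats n"
  shows "G = G'"
proof -
  note sym = has_gradient_sym[OF G] has_gradient_sym[OF G']
  note c = sym[THEN sym_matsD(1)]
  have D: "G - G' \<in> sym_mats n"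
    using sym by blast
  have X0: "X + 0 \<cdot>\<^sub>m (G - G') = X"
    using X c by (intro eq_matI) (auto simp: carrier_matD[OF sym_matsD(1)[OF X]])
  have "mat_inner G (G - G') = mat_inner G' (G - G')"
    using has_gradient_DERIV[OF _ X D, of f 0 G] has_gradient_DERIV[OF _ X D, of f 0 G'] G G'
    unfolding X0 by (blast intro: DERIV_unique)
  then have "mat_inner (G - G') (G - G') = 0"
    using c by (simp add: mat_inner_minus_left[of _ n])
  then show ?thesis
    using c by (intro fro_norm_eq_0) (auto simp: fro_norm_def)
qed

lemma smooth_sym_has_gradient:
  assumes "smooth_sym n \<beta> f" "X \<in> sym_mats n"
  shows "has_gradient n f X (gradient n f X)"
proof -
  obtain G where G: "has_gradient n f X G"
    using assms by (auto simp: smooth_sym_def)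
  show ?thesis
    unfolding gradient_def using G
    by (rule theI) (rule has_gradient_unique[OF _ G assms(2)])
qed

text \<open>F is f along the segment minus its quadratic upper model, up to the constant f X; the
  Lipschitz bound on the gradient makes its derivative nonpositive on [0, 1].\<close>

lemma smooth_sym_descent:
  assumes f: "smooth_sym n \<beta> f" and X: "X \<in> sym_mats n" and D: "D \<in> sym_mats n"
  shows "f (X + D) \<le> f X + mat_inner (gradient n f X) D + \<beta> / 2 * (fro_norm D)\<^sup>2"
proof -
  note Xc = sym_matsD(1)[OF X] and Dc = sym_matsD(1)[OF D]
  define N where "N = fro_norm D"
  define G where "G = gradient n f X"
  define F where "F = (\<lambda>s. f (X + s \<cdot>\<^sub>m D) - s * mat_inner G D - s\<^sup>2 * (\<beta> / 2 * N\<^sup>2))"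
  note Gc = sym_matsD(1)[OF has_gradient_sym[OF smooth_sym_has_gradient[OF f X]], folded G_def]
  have "F 1 \<le> F 0"
  proof (rule DERIV_nonpos_imp_nonincreasing[where f = F and a = 0 and b = 1])
    fix s :: real assume s: "0 \<le> s" "s \<le> 1"
    define Y where "Y = X + s \<cdot>\<^sub>m D"
    have Y: "Y \<in> sym_mats n"
      using X D unfolding Y_def by blast
    define H where "H = gradient n f Y"
    note H = smooth_sym_has_gradient[OF f Y, folded H_def]
    note Hc = sym_matsD(1)[OF has_gradient_sym[OF H]]
    have "(F has_real_derivative (mat_inner H D - mat_inner G D - 2 * s * (\<beta> / 2 * N\<^sup>2))) (at s)"
      unfolding F_def using H unfolding Y_def
      by (auto intro!: derivative_eq_intros has_gradient_DERIV[OF _ X D])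
    moreover have "mat_inner H D - mat_inner G D - 2 * s * (\<beta> / 2 * N\<^sup>2) \<le> 0"
    proof -
      have "mat_inner H D - mat_inner G D = mat_inner (H - G) D"
        using Hc Gc Dc by (simp add: mat_inner_minus_left[of _ n])
      also have "\<dots> \<le> fro_norm (H - G) * N"
        unfolding N_def using mat_inner_Cauchy_Schwarz[of "H - G" n D] Hc Gc Dc by simp
      also have "\<dots> \<le> \<beta> * fro_norm (Y - X) * N"
        using f Y X fro_norm_nonneg[OF Dc]
        by (intro mult_right_mono) (auto simp: smooth_sym_def H_def G_def N_def)
      also have "fro_norm (Y - X) = s * N"
        unfolding Y_def add_smult_minus_self[OF Xc Dc] fro_norm_smult[OF Dc] N_def using s by simp
      finally show ?thesis
        by (simp add: power2_eq_square algebra_simps)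
    qed
    ultimately show "\<exists>y. (F has_real_derivative y) (at s) \<and> y \<le> 0"
      by blast
  qed simp
  moreover have "X + 1 \<cdot>\<^sub>m D = X + D" "X + 0 \<cdot>\<^sub>m D = X"
    using Xc Dc by (auto intro!: eq_matI)
  ultimately show ?thesis
    by (simp add: F_def N_def G_def)
qed

text \<open>Compare convexity with the first-order expansion at X + s (Y - X) for a small s > 0 and
  divide by s; the expansion error becomes the slack \<epsilon>.\<close>

lemma convex_sym_gradient_le:
  assumes f: "convex_sym n f" and G: "has_gradient n f X G"
    and X: "X \<in> sym_mats n" and Y: "Y \<in> sym_mats n"
  shows "f X + mat_inner G (Y - X) \<le> f Y"
proof (rule field_le_epsilon)
  fix \<epsilon> :: real assume "\<epsilon> > 0"
  have D: "Y - X \<in> sym_mats n"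
    using X Y by blast
  obtain r where r: "r > 0" "\<And>s. \<bar>s\<bar> < r \<Longrightarrow>
      \<bar>f (X + s \<cdot>\<^sub>m (Y - X)) - f X - s * mat_inner G (Y - X)\<bar> \<le> \<epsilon> * \<bar>s\<bar>"
    using has_gradientD[OF G X D \<open>\<epsilon> > 0\<close>] by blast
  define s where "s = min 1 (r / 2)"
  have s: "0 < s" "s \<le> 1" "\<bar>s\<bar> < r"
    using r(1) by (auto simp: s_def)
  have "f (X + s \<cdot>\<^sub>m (Y - X)) \<le> (1 - s) * f X + s * f Y"
    using f X Y s unfolding convex_sym_def
    by (simp flip: convex_combination_eq[OF sym_matsD(1)[OF X] sym_matsD(1)[OF Y]])
  then have "s * (f X + mat_inner G (Y - X)) \<le> s * (f Y + \<epsilon>)"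
    using r(2)[OF s(3)] s(1) by (simp add: algebra_simps abs_le_iff)
  then show "f X + mat_inner G (Y - X) \<le> f Y + \<epsilon>"
    using s(1) by simp
qed

section \<open>The Frank-Wolfe iteration\<close>

locale frank_wolfe_run =
  fixes n :: nat and \<beta> :: real and f :: "real mat \<Rightarrow> real"
    and X :: "nat \<Rightarrow> real mat" and v :: "nat \<Rightarrow> real vec"
  assumes cvx: "convex_sym n f" and smooth: "smooth_sym n \<beta> f" and run: "frank_wolfe n \<beta> f X v"
begin

abbreviation "grad \<equiv> gradient n f"
abbreviation "V t \<equiv> outer (v t)"
abbreviation "h t \<equiv> opt_gap n f (X t)"

definition fw_gap :: "nat \<Rightarrow> real" where
  "fw_gap t = mat_inner (X t - V t) (grad (X t))"

lemma grad: "Y \<in> sym_mats n \<Longrightarrow> has_gradient n f Y (grad Y)"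
  by (rule smooth_sym_has_gradient[OF smooth])

lemma grad_sym: "Y \<in> sym_mats n \<Longrightarrow> grad Y \<in> sym_mats n"
  by (rule has_gradient_sym[OF grad])

lemma gradient_le:
  "Y \<in> sym_mats n \<Longrightarrow> Z \<in> sym_mats n \<Longrightarrow> f Y + mat_inner (grad Y) (Z - Y) \<le> f Z"
  by (rule convex_sym_gradient_le[OF cvx grad])

lemma X_spectrahedron:
  assumes "t \<ge> 1"
  shows "X t \<in> spectrahedron n"
  using assms
proof (induction t rule: dec_induct)
  case base
  then show ?case
    using run by (simp add: frank_wolfe_def)
next
  case (step t)
  note spec = step.IH
  obtain \<eta> where \<eta>: "\<eta> \<in> {0..1}" "X (Suc t) = (1 - \<eta>) \<cdot>\<^sub>m X t + \<eta> \<cdot>\<^sub>m V t"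
    using run step.hyps unfolding frank_wolfe_def by auto
  have "dim_row (grad (X t)) = n"
    using grad_sym[OF spectrahedron_sym[OF spec], THEN sym_matsD(1)] by simp
  then have "v t \<in> carrier_vec n" "v t \<bullet> v t = 1"
    using run step.hyps unfolding frank_wolfe_def eigenvector_def by auto
  then show ?case
    unfolding \<eta>(2) by (intro spectrahedron_convex spec outer_spectrahedron \<eta>(1))
qed

lemma X_sym: "t \<ge> 1 \<Longrightarrow> X t \<in> sym_mats n"
  by (rule spectrahedron_sym[OF X_spectrahedron])

text \<open>Restates the top eigenpair of the negated gradient as an eigenpair of the gradient;
  \<open>v_min\<close> then shows that its value is the bottom one.\<close>

lemma v_eigenvector:
  assumes t: "t \<ge> 1"
  shows "v t \<in> carrier_vec n" "v t \<bullet> v t = 1"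
    "grad (X t) *\<^sub>v v t = (- eigval (- grad (X t)) 1) \<cdot>\<^sub>v v t"
proof -
  note G = sym_matsD(1)[OF grad_sym[OF X_sym[OF t]]]
  have "eigenvector (- grad (X t)) (v t) (eigval (- grad (X t)) 1)"
    using run t unfolding frank_wolfe_def by blast
  then have v: "v t \<in> carrier_vec n"
      "- grad (X t) *\<^sub>v v t = eigval (- grad (X t)) 1 \<cdot>\<^sub>v v t"
    using G by (auto simp: eigenvector_def)
  show "v t \<in> carrier_vec n"
    by (rule v(1))
  show "v t \<bullet> v t = 1"
    using run t unfolding frank_wolfe_def by blast
  have "- (grad (X t) *\<^sub>v v t) = eigval (- grad (X t)) 1 \<cdot>\<^sub>v v t"
    using v G by (simp add: uminus_mult_mat_vec)
  then have neg: "(- (grad (X t) *\<^sub>v v t)) $ i = (eigval (- grad (X t)) 1 \<cdot>\<^sub>v v t) $ i" for i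
    by simp
  show "grad (X t) *\<^sub>v v t = (- eigval (- grad (X t)) 1) \<cdot>\<^sub>v v t"
  proof (rule eq_vecI)
    fix i assume "i < dim_vec ((- eigval (- grad (X t)) 1) \<cdot>\<^sub>v v t)"
    then show "(grad (X t) *\<^sub>v v t) $ i = ((- eigval (- grad (X t)) 1) \<cdot>\<^sub>v v t) $ i"
      using neg[of i] v(1) G by simp
  qed (use v(1) G in simp)
qed

lemma v_min:
  assumes t: "t \<ge> 1" and y: "y \<in> carrier_vec n"
  shows "(- eigval (- grad (X t)) 1) * (y \<bullet> y) \<le> y \<bullet> (grad (X t) *\<^sub>v y)"
proof -
  note G = grad_sym[OF X_sym[OF t]]
  have "y \<bullet> (- grad (X t) *\<^sub>v y) \<le> eigval (- grad (X t)) 1 * (y \<bullet> y)"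
    by (rule quadratic_form_le_eigval_1[OF sym_mats_uminus[OF G] y])
  moreover have "y \<bullet> (- grad (X t) *\<^sub>v y) = - (y \<bullet> (grad (X t) *\<^sub>v y))"
    using y sym_matsD(1)[OF G] by simp
  ultimately show ?thesis
    by simp
qed

lemma V_spectrahedron: "t \<ge> 1 \<Longrightarrow> V t \<in> spectrahedron n"
  using v_eigenvector by (intro outer_spectrahedron)

lemma V_sym: "t \<ge> 1 \<Longrightarrow> V t \<in> sym_mats n"
  by (rule spectrahedron_sym[OF V_spectrahedron])

lemma linear_minimizer:
  assumes t: "t \<ge> 1" and Y: "Y \<in> spectrahedron n"
  shows "mat_inner (V t) (grad (X t)) \<le> mat_inner Y (grad (X t))"
proof -
  note G = sym_matsD(1)[OF grad_sym[OF X_sym[OF t]]] and v = v_eigenvector[OF t]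
  have "mat_inner (V t) (grad (X t)) = - eigval (- grad (X t)) 1"
    using G v by (simp add: mat_inner_outer[of _ n])
  also have "\<dots> \<le> mat_inner Y (grad (X t))"
    using v_min[OF t] by (intro spectrahedron_mat_inner_ge[OF Y G]) force
  finally show ?thesis .
qed

text \<open>Convexity bounds f Y below by the linearization at X t, whose minimum over the
  spectrahedron is attained at V t.\<close>

lemma f_ge_fw_gap:
  assumes t: "t \<ge> 1" and Y: "Y \<in> spectrahedron n"
  shows "f (X t) - fw_gap t \<le> f Y"
proof -
  note sym = X_sym[OF t] V_sym[OF t] spectrahedron_sym[OF Y] grad_sym[OF X_sym[OF t]]
  note c = sym[THEN sym_matsD(1)]
  show ?thesis
    using gradient_le[OF sym(1,3)] linear_minimizer[OF t Y] c
      mat_inner_commute[of "grad (X t)" n "Y - X t"]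
    by (simp add: fw_gap_def mat_inner_minus_left[of _ n])
qed

text \<open>Makes the real infimum inside \<open>opt_gap\<close> meaningful.\<close>

lemma bdd_below_f: "bdd_below (f ` spectrahedron n)"
  using f_ge_fw_gap[of 1] by (intro bdd_belowI2[of _ "f (X 1) - fw_gap 1"]) auto

lemma h_nonneg: "t \<ge> 1 \<Longrightarrow> h t \<ge> 0"
  using cINF_lower[OF bdd_below_f X_spectrahedron] by (simp add: opt_gap_def)

lemma h_le_fw_gap:
  assumes "t \<ge> 1"
  shows "h t \<le> fw_gap t"
proof -
  have "f (X t) - fw_gap t \<le> (INF Y\<in>spectrahedron n. f Y)"
    using X_spectrahedron[of 1] f_ge_fw_gap[OF assms] by (intro cINF_greatest) auto
  then show ?thesis
    by (simp add: opt_gap_def)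
qed

text \<open>Both options are compared with the same quadratic model q, which dominates f along the
  segment. Exact search does at least as well as f at s, hence as q s; the second option makes q at
  its own step at most q s.\<close>

lemma progress:
  assumes t: "t \<ge> 1" and s: "s \<in> {0..1}"
  shows "h (Suc t) \<le> h t - s * fw_gap t + s\<^sup>2 * (\<beta> / 2 * (fro_norm (X t - V t))\<^sup>2)"
proof -
  note sym = X_sym[OF t] V_sym[OF t] grad_sym[OF X_sym[OF t]]
  note c = sym[THEN sym_matsD(1)]
  define q where "q = (\<lambda>s. f (X t) + s * mat_inner (V t - X t) (grad (X t))
    + s\<^sup>2 * \<beta> / 2 * (fro_norm (X t - V t))\<^sup>2)"
  define move where "move = (\<lambda>s. (1 - s) \<cdot>\<^sub>m X t + s \<cdot>\<^sub>m V t)"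
  have model: "f (move s) \<le> q s" for s
  proof -
    have "f (X t + s \<cdot>\<^sub>m (V t - X t)) \<le> f (X t) + mat_inner (grad (X t)) (s \<cdot>\<^sub>m (V t - X t))
        + \<beta> / 2 * (fro_norm (s \<cdot>\<^sub>m (V t - X t)))\<^sup>2"
      using sym by (intro smooth_sym_descent[OF smooth]) auto
    also have "mat_inner (grad (X t)) (s \<cdot>\<^sub>m (V t - X t)) = s * mat_inner (V t - X t) (grad (X t))"
      using c mat_inner_commute[of "grad (X t)" n "V t - X t"]
      by (simp add: mat_inner_smult_right[of _ n])
    also have "fro_norm (s \<cdot>\<^sub>m (V t - X t)) = \<bar>s\<bar> * fro_norm (X t - V t)"
      using c by (simp add: fro_norm_smult[of _ n] fro_norm_commute[of "V t" n])
    finally show ?thesis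
      by (simp add: q_def move_def convex_combination_eq[OF c(1,2)] power_mult_distrib mult_ac)
  qed
  obtain \<eta> where \<eta>: "\<eta> \<in> {0..1}" "X (Suc t) = move \<eta>"
    "exact_line_search f (X t) (v t) \<eta> \<or> quadratic_line_search n \<beta> f (X t) (v t) \<eta>"
    using run t unfolding frank_wolfe_def move_def by blast
  from \<eta>(3) have "f (X (Suc t)) \<le> q s"
  proof
    assume "exact_line_search f (X t) (v t) \<eta>"
    then have "f (move \<eta>) \<le> f (move s)"
      using s unfolding exact_line_search_def is_arg_min_linorder move_def by blast
    also have "\<dots> \<le> q s"
      by (rule model)
    finally show ?thesis
      by (simp add: \<eta>(2))
  next
    assume "quadratic_line_search n \<beta> f (X t) (v t) \<eta>"
    then have "q \<eta> \<le> q s"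
      using s unfolding quadratic_line_search_def is_arg_min_linorder q_def by blast
    then show ?thesis
      using model[of \<eta>] by (simp add: \<eta>(2))
  qed
  then show ?thesis
    using c by (simp add: opt_gap_def q_def fw_gap_def mat_inner_minus_left[of _ n] algebra_simps)
qed

text \<open>A negative Lipschitz constant would force any two symmetric matrices to coincide, yet X
  1 has trace 1 and the zero matrix has trace 0.\<close>

lemma beta_nonneg: "\<beta> \<ge> 0"
proof (rule ccontr)
  assume "\<not> \<beta> \<ge> 0"
  have X1: "X 1 \<in> carrier_mat n n" "X 1 \<in> sym_mats n" and Z: "0\<^sub>m n n \<in> sym_mats n"
    using X_sym[of 1] by (auto intro: sym_matsI)
  have "0 \<le> fro_norm (grad (X 1) - grad (0\<^sub>m n n))"
    using grad_sym[OF X1(2)] grad_sym[OF Z] by (intro fro_norm_nonneg[of _ n]) auto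
  also have "\<dots> \<le> \<beta> * fro_norm (X 1 - 0\<^sub>m n n)"
    using smooth X1 Z by (simp add: smooth_sym_def)
  finally have "fro_norm (X 1 - 0\<^sub>m n n) = 0"
    using \<open>\<not> \<beta> \<ge> 0\<close> fro_norm_nonneg[of "X 1 - 0\<^sub>m n n" n] X1(1)
    by (simp add: zero_le_mult_iff)
  then have "X 1 = 0\<^sub>m n n"
    using X1(1) by (intro fro_norm_eq_0) auto
  moreover have "mat_trace (0\<^sub>m n n) = 0"
    by (simp add: mat_trace_def diag_mat_def sum_list_sum_nth)
  ultimately show False
    using X_spectrahedron[of 1] by (simp add: spectrahedron_def)
qed

lemma progress_diameter:
  assumes t: "t \<ge> 1" and s: "s \<in> {0..1}"
  shows "h (Suc t) \<le> (1 - s) * h t + s\<^sup>2 * \<beta>"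
proof -
  have "s * h t \<le> s * fw_gap t"
    using s h_le_fw_gap[OF t] by (intro mult_left_mono) auto
  moreover have "s\<^sup>2 * (\<beta> / 2 * (fro_norm (X t - V t))\<^sup>2) \<le> s\<^sup>2 * (\<beta> / 2 * 2)"
    using beta_nonneg spectrahedron_diameter[OF X_spectrahedron[OF t] V_spectrahedron[OF t]]
    by (intro mult_left_mono) auto
  ultimately show ?thesis
    using progress[OF t s] by (simp add: algebra_simps)
qed

text \<open>The induction starts at t = 2, where 2/t first lies in [0, 1]. For the base, the full
  step s = 1 from t = 1 cancels h 1 and leaves \<beta>; afterwards s = 2/t, and (r - 1)/r^2 \<le>
  1/(r + 1) closes the step.\<close>

lemma sublinear_rate:
  assumes "t \<ge> 2"
  shows "h t \<le> 4 * (\<beta> / real t)"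
  using assms
proof (induction t rule: dec_induct)
  case base
  then show ?case
    using progress_diameter[of 1 1] beta_nonneg by (simp add: numeral_2_eq_2)
next
  case (step t)
  define r where "r = real t"
  have r: "r \<ge> 2"
    using step.hyps by (simp add: r_def)
  have "h (Suc t) \<le> (1 - 2 / r) * h t + (2 / r)\<^sup>2 * \<beta>"
    using step.hyps r by (intro progress_diameter) auto
  also have "\<dots> \<le> (1 - 2 / r) * (4 * (\<beta> / r)) + (2 / r)\<^sup>2 * \<beta>"
    using step.IH r by (intro add_right_mono mult_left_mono) (auto simp: r_def)
  also have "\<dots> = 4 * \<beta> * ((r - 1) / r\<^sup>2)"
    using r by (simp add: field_simps power2_eq_square)
  also have "\<dots> \<le> 4 * \<beta> * (1 / (r + 1))"
    using r beta_nonneg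
    by (intro mult_left_mono) (auto simp: field_simps power2_eq_square)
  finally show ?case
    by (simp add: r_def add.commute)
qed

end

section \<open>Local linear convergence under a spectral gap at the minimizer\<close>

locale frank_wolfe_gap = frank_wolfe_run +
  fixes Xs :: "real mat" and \<delta> :: real
  assumes n: "2 \<le> n" and minimizer: "is_arg_min f (\<lambda>Y. Y \<in> spectrahedron n) Xs"
    and gap_def: "\<delta> = eigval (grad Xs) (n - 1) - eigval (grad Xs) n" and gap_pos: "\<delta> > 0"
begin

lemma Xs_spectrahedron: "Xs \<in> spectrahedron n"
  and Xs_min: "Y \<in> spectrahedron n \<Longrightarrow> f Xs \<le> f Y"
  using minimizer by (auto simp: is_arg_min_linorder)

lemma Xs_sym: "Xs \<in> sym_mats n"
  by (rule spectrahedron_sym[OF Xs_spectrahedron])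

lemma h_eq: "h t = f (X t) - f Xs"
proof -
  have "(INF Y\<in>spectrahedron n. f Y) = f Xs"
    using Xs_spectrahedron Xs_min by (intro cInf_eq_minimum) auto
  then show ?thesis
    by (simp add: opt_gap_def)
qed

lemma first_order_optimality:
  assumes Y: "Y \<in> spectrahedron n"
  shows "0 \<le> mat_inner (Y - Xs) (grad Xs)"
proof (rule ccontr)
  note sym = Xs_sym spectrahedron_sym[OF Y] grad_sym[OF Xs_sym]
  note c = sym[THEN sym_matsD(1)]
  define a where "a = mat_inner (Y - Xs) (grad Xs)"
  define b where "b = \<beta> / 2 * (fro_norm (Y - Xs))\<^sup>2"
  assume "\<not> ?thesis"
  then have a: "a < 0"
    by (simp add: a_def)
  have b: "b \<ge> 0"
    using beta_nonneg by (simp add: b_def)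
  \<comment> \<open>This s makes a + s b at most a/2 < 0, so f would decrease along the segment; b +
    1 guards against b = 0.\<close>
  define s where "s = min 1 (- a / (2 * (b + 1)))"
  have s: "0 < s" "s \<le> 1" "s \<le> - a / (2 * (b + 1))"
    using a b by (auto simp: s_def divide_neg_pos)
  have "f Xs \<le> f ((1 - s) \<cdot>\<^sub>m Xs + s \<cdot>\<^sub>m Y)"
    using s by (intro Xs_min spectrahedron_convex Xs_spectrahedron Y) auto
  also have "\<dots> \<le> f Xs + mat_inner (grad Xs) (s \<cdot>\<^sub>m (Y - Xs)) + \<beta> / 2 * (fro_norm (s \<cdot>\<^sub>m (Y - Xs)))\<^sup>2"
    unfolding convex_combination_eq[OF c(1,2)] using sym
    by (intro smooth_sym_descent[OF smooth]) auto
  also have "\<dots> = f Xs + s * (a + s * b)"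
    using c mat_inner_commute[of "grad Xs" n "Y - Xs"]
    by (simp add: mat_inner_smult_right[of _ n] fro_norm_smult[of _ n] a_def b_def
        power_mult_distrib power2_eq_square algebra_simps)
  finally have "0 \<le> a + s * b"
    using s(1) by (simp add: zero_le_mult_iff)
  also have "s * b \<le> s * (b + 1)"
    using s(1) by simp
  also have "s * (b + 1) \<le> - a / 2"
    using s(3) b by (simp add: field_simps)
  finally show False
    using a by simp
qed

text \<open>Growth evaluated at Xs itself and optimality tested at \<open>outer x\<close> bound the
  same inner product from both sides, so the distance between them vanishes.\<close>

lemma minimizer_rank_one:
  obtains x where "Xs = outer x" "gap_form n (grad Xs) x (eigval (grad Xs) n) \<delta>"
proof -
  note G = grad_sym[OF Xs_sym]
  obtain x where x: "gap_form n (grad Xs) x (eigval (grad Xs) n) \<delta>"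
    using eigval_gap_form[OF G n] gap_def by blast
  then have o: "outer x \<in> spectrahedron n"
    by (intro outer_spectrahedron) (auto simp: gap_form_def)
  note c = Xs_sym[THEN sym_matsD(1)] spectrahedron_sym[OF o, THEN sym_matsD(1)] G[THEN sym_matsD(1)]
  have "\<delta> / 2 * (fro_norm (Xs - outer x))\<^sup>2 \<le> mat_inner (Xs - outer x) (grad Xs)"
    using gap_form_growth[OF Xs_spectrahedron G x] gap_pos by simp
  also have "\<dots> \<le> 0"
    using first_order_optimality[OF o] c by (simp add: mat_inner_minus_left[of _ n])
  finally have "fro_norm (Xs - outer x) = 0"
    using gap_pos by (simp add: mult_le_0_iff)
  then have "Xs = outer x"
    by (rule fro_norm_eq_0[OF c(1,2)])
  then show ?thesis
    using x that by blast
qed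

lemma linear_growth:
  assumes "Y \<in> spectrahedron n"
  shows "\<delta> / 2 * (fro_norm (Y - Xs))\<^sup>2 \<le> mat_inner (Y - Xs) (grad Xs)"
proof (rule minimizer_rank_one)
  fix x assume x: "Xs = outer x" "gap_form n (grad Xs) x (eigval (grad Xs) n) \<delta>"
  show ?thesis
    using gap_form_growth[OF assms grad_sym[OF Xs_sym] x(2)] gap_pos by (simp flip: x(1))
qed

lemma quadratic_growth:
  assumes t: "t \<ge> 1"
  shows "\<delta> / 2 * (fro_norm (X t - Xs))\<^sup>2 \<le> h t"
proof -
  note c = Xs_sym[THEN sym_matsD(1)] X_sym[OF t, THEN sym_matsD(1)]
    grad_sym[OF Xs_sym, THEN sym_matsD(1)]
  have "f Xs + mat_inner (X t - Xs) (grad Xs) \<le> f (X t)"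
    using gradient_le[OF Xs_sym X_sym[OF t]] c mat_inner_commute[of "grad Xs" n "X t - Xs"] by simp
  then show ?thesis
    using linear_growth[OF X_spectrahedron[OF t]] by (simp add: h_eq)
qed

lemma grad_close:
  "t \<ge> 1 \<Longrightarrow> fro_norm (grad (X t) - grad Xs) \<le> \<beta> * fro_norm (X t - Xs)"
  using smooth X_sym Xs_sym by (simp add: smooth_sym_def)

text \<open>The gradient at Xs charges V t at least \<delta>/2 times its squared distance from Xs,
  while the gradient at X t ranks V t no worse than Xs. The difference of the gradients must
  therefore pay for this, and Cauchy-Schwarz lets one factor of the distance cancel.\<close>

lemma eigenvector_distance:
  assumes t: "t \<ge> 1"
  shows "\<delta> * fro_norm (V t - Xs) \<le> 2 * \<beta> * fro_norm (X t - Xs)"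
proof -
  note sym = Xs_sym X_sym[OF t] V_sym[OF t] grad_sym[OF Xs_sym] grad_sym[OF X_sym[OF t]]
  note c = sym[THEN sym_matsD(1)]
  define b where "b = fro_norm (V t - Xs)"
  have b: "b \<ge> 0"
    using c by (simp add: b_def fro_norm_nonneg[of _ n])
  have "\<delta> / 2 * b\<^sup>2 \<le> mat_inner (V t - Xs) (grad Xs)"
    unfolding b_def by (rule linear_growth[OF V_spectrahedron[OF t]])
  also have "\<dots> \<le> mat_inner (V t - Xs) (grad Xs - grad (X t))"
    using linear_minimizer[OF t Xs_spectrahedron] c by (simp add: mat_inner_linear[of _ n])
  also have "\<dots> \<le> b * fro_norm (grad Xs - grad (X t))"
    unfolding b_def using mat_inner_Cauchy_Schwarz[of "V t - Xs" n "grad Xs - grad (X t)"] c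
    by simp
  also have "\<dots> \<le> b * (\<beta> * fro_norm (X t - Xs))"
    using b grad_close[OF t] fro_norm_commute[OF c(4,5)] by (intro mult_left_mono) auto
  finally have "b * (\<delta> * b) \<le> b * (2 * \<beta> * fro_norm (X t - Xs))"
    by (simp add: power2_eq_square algebra_simps)
  then show ?thesis
    using b beta_nonneg c fro_norm_nonneg[of "X t - Xs" n]
    by (cases "b = 0") (simp_all flip: b_def)
qed

lemma eigenvector_rate:
  assumes t: "t \<ge> 1"
  shows "(fro_norm (V t - Xs))\<^sup>2 \<le> 8 * (\<beta>\<^sup>2 / \<delta> ^ 3 * h t)"
proof -
  define a where "a = fro_norm (X t - Xs)"
  define b where "b = fro_norm (V t - Xs)"
  have b: "b \<ge> 0"
    using Xs_sym V_sym[OF t] by (simp add: b_def fro_norm_nonneg[of _ n])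
  have "(\<delta> * b)\<^sup>2 \<le> (2 * \<beta> * a)\<^sup>2"
    using eigenvector_distance[OF t] b gap_pos unfolding a_def b_def
    by (intro power_mono) auto
  then have "\<delta> * (\<delta>\<^sup>2 * b\<^sup>2) \<le> \<delta> * (4 * \<beta>\<^sup>2 * a\<^sup>2)"
    using gap_pos by (simp add: power_mult_distrib)
  also have "\<dots> = 8 * \<beta>\<^sup>2 * (\<delta> / 2 * a\<^sup>2)"
    by simp
  also have "\<dots> \<le> 8 * \<beta>\<^sup>2 * h t"
    using quadratic_growth[OF t] unfolding a_def by (intro mult_left_mono) auto
  finally have "\<delta> ^ 3 * b\<^sup>2 \<le> 8 * \<beta>\<^sup>2 * h t"
    by (simp add: power2_eq_square power3_eq_cube mult.assoc)
  then show ?thesis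
    using gap_pos by (simp add: b_def field_simps)
qed

lemma linear_progress:
  assumes t: "t \<ge> 1" and close: "\<beta> * fro_norm (X t - Xs) \<le> \<delta> / 6"
  shows "h (Suc t) \<le> h t * (1 - min (\<delta> / (12 * \<beta>)) (1 / 2))"
proof (cases "\<beta> = 0")
  case True
  \<comment> \<open>Division by zero makes \<delta> / (12 * 0) equal to 0, so the contraction factor
    is 1 and the step s = 0 suffices.\<close>
  then show ?thesis
    using progress[OF t, of 0] by simp
next
  case False
  then have \<beta>: "\<beta> > 0"
    using beta_nonneg by simp
  define D where "D = (fro_norm (X t - V t))\<^sup>2"
  have "gap_form n (grad (X t)) (v t) (- eigval (- grad (X t)) 1) (\<delta> / 3)"
  proof (rule minimizer_rank_one)
    fix x assume x: "gap_form n (grad Xs) x (eigval (grad Xs) n) \<delta>"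
    show ?thesis
      using gap_pos grad_close[OF t] close
      by (intro gap_form_perturb[OF grad_sym[OF Xs_sym] grad_sym[OF X_sym[OF t]] x]
          v_eigenvector[OF t] v_min[OF t]) auto
  qed
  from gap_form_growth[OF X_spectrahedron[OF t] grad_sym[OF X_sym[OF t]] this]
  have growth: "\<delta> / 6 * D \<le> fw_gap t"
    using gap_pos by (simp add: fw_gap_def D_def)
  have D: "D \<ge> 0"
    by (simp add: D_def)
  have g: "fw_gap t \<ge> h t" "h t \<ge> 0"
    using h_le_fw_gap[OF t] h_nonneg[OF t] by auto
  \<comment> \<open>With s \<beta> \<le> \<delta>/6 the quadratic term is at most half of the linear
    gain s \<open>fw_gap t\<close>. The remaining half produces s/2, which is the minimum in the
    statement.\<close>
  define s where "s = min (\<delta> / (6 * \<beta>)) 1"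
  have s: "0 \<le> s" "s \<le> 1" "s * \<beta> \<le> \<delta> / 6"
  proof -
    show "0 \<le> s" "s \<le> 1"
      using \<beta> gap_pos by (auto simp: s_def)
    have "s * \<beta> \<le> \<delta> / (6 * \<beta>) * \<beta>"
      using \<beta> by (intro mult_right_mono) (auto simp: s_def)
    then show "s * \<beta> \<le> \<delta> / 6"
      using \<beta> by simp
  qed
  have "s\<^sup>2 * (\<beta> / 2 * D) = s / 2 * (s * \<beta> * D)"
    by (simp add: power2_eq_square)
  also have "\<dots> \<le> s / 2 * (\<delta> / 6 * D)"
    using s D by (intro mult_left_mono mult_right_mono) auto
  also have "\<dots> \<le> s / 2 * fw_gap t"
    using s growth by (intro mult_left_mono) auto
  finally have "h (Suc t) \<le> h t - s / 2 * fw_gap t"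
    using progress[OF t, of s] s by (simp add: D_def)
  also have "\<dots> \<le> h t - s / 2 * h t"
    using s g by (intro diff_left_mono mult_left_mono) auto
  also have "s / 2 = min (\<delta> / (12 * \<beta>)) (1 / 2)"
    by (auto simp: s_def min_def)
  finally show ?thesis
    by (simp add: algebra_simps)
qed

text \<open>Quadratic growth and the sublinear rate give (\<rho> a)^2 \<le> 8 \<rho>^3 / t for t at
  least 2, and this must drop to 1/36. The constant 2000 leaves room for the rounding in the
  floor.\<close>

lemma eventually_close:
  assumes t: "t \<ge> 1" and T: "t \<ge> nat \<lfloor>2000 * (\<beta> / \<delta>) ^ 3\<rfloor>"
  shows "\<beta> * fro_norm (X t - Xs) \<le> \<delta> / 6"
proof -
  define \<rho> where "\<rho> = \<beta> / \<delta>"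
  define a where "a = fro_norm (X t - Xs)"
  have \<rho>: "\<rho> \<ge> 0"
    using beta_nonneg gap_pos by (simp add: \<rho>_def)
  have "(\<rho> * a)\<^sup>2 \<le> (1 / 6)\<^sup>2"
  proof (cases "t = 1")
    case True
    have "2000 * \<rho> ^ 3 < 2"
      using T True unfolding \<rho>_def[symmetric] by linarith
    then have "\<rho> ^ 3 < (1 / 10) ^ 3"
      by (simp add: power3_eq_cube)
    then have "\<rho> \<le> 1 / 10"
      using power_less_imp_less_base[of \<rho> 3 "1 / 10"] by simp
    then have "\<rho>\<^sup>2 \<le> (1 / 10)\<^sup>2"
      using \<rho> by (intro power_mono)
    moreover have "a\<^sup>2 \<le> 2"
      unfolding a_def by (rule spectrahedron_diameter[OF X_spectrahedron[OF t] Xs_spectrahedron])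
    ultimately have "\<rho>\<^sup>2 * a\<^sup>2 \<le> (1 / 10)\<^sup>2 * 2"
      by (intro mult_mono) auto
    then show ?thesis
      by (simp add: power_mult_distrib power_divide)
  next
    case False
    then have t2: "t \<ge> 2"
      using t by simp
    \<comment> \<open>The floor costs an additive 1, absorbed by t + 1 \<le> 2 t; this halves 2000
      to 1000.\<close>
    have "2000 * \<rho> ^ 3 < real t + 1"
      using T unfolding \<rho>_def[symmetric] by linarith
    then have \<rho>3: "1000 * \<rho> ^ 3 \<le> real t"
      using t2 by simp
    have "\<delta> / 2 * a\<^sup>2 \<le> 4 * (\<beta> / real t)"
      using quadratic_growth[OF t] sublinear_rate[OF t2] by (simp add: a_def)
    then have "a\<^sup>2 \<le> 8 * \<rho> / real t"
      using gap_pos t2 by (simp add: \<rho>_def field_simps)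
    then have "\<rho>\<^sup>2 * a\<^sup>2 \<le> \<rho>\<^sup>2 * (8 * \<rho> / real t)"
      by (intro mult_left_mono) auto
    also have "\<dots> = 8 * \<rho> ^ 3 / real t"
      by (simp add: power2_eq_square power3_eq_cube)
    also have "\<dots> \<le> 8 / 1000"
      using \<rho>3 t2 by (simp add: field_simps)
    finally show ?thesis
      by (simp add: power_mult_distrib power_divide)
  qed
  then have "\<rho> * a \<le> 1 / 6"
    by (rule power2_le_imp_le) simp
  then show ?thesis
    using gap_pos by (simp add: \<rho>_def a_def field_simps)
qed

end

text \<open>Part (i) starts at t = 2 because X 1 is arbitrary: a linear f is smooth with \<beta> =
  0, yet its gap at X 1 can be positive, so no multiple of \<beta> bounds it.\<close>

theorem theorem2:
  shows "\<exists>C1 > 0. \<exists>C2 > 0. \<exists>C3 > (0::real).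
    \<forall>(n::nat) (\<beta>::real) (f :: real mat \<Rightarrow> real) (X :: nat \<Rightarrow> real mat) (v :: nat \<Rightarrow> real vec).
      convex_sym n f \<and> smooth_sym n \<beta> f \<and> frank_wolfe n \<beta> f X v \<longrightarrow>
        (\<forall>t\<ge>2. opt_gap n f (X t) \<le> C1 * (\<beta> / real t)) \<and>
        (\<forall>Xs \<delta>.
           2 \<le> n \<and> is_arg_min f (\<lambda>Y. Y \<in> spectrahedron n) Xs \<and>
           \<delta> = eigval (gradient n f Xs) (n - 1) - eigval (gradient n f Xs) n \<and> \<delta> > 0 \<longrightarrow>
             (\<exists>T0::nat. real T0 \<le> C2 * (\<beta> / \<delta>) ^ 3 \<and>
                (\<forall>t\<ge>1. t \<ge> T0 \<longrightarrow>
                   opt_gap n f (X (Suc t)) \<le> opt_gap n f (X t) * (1 - min (\<delta> / (12 * \<beta>)) (1 / 2)))) \<and>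
             (\<forall>t\<ge>1. (fro_norm (outer (v t) - Xs))\<^sup>2 \<le> C3 * (\<beta>\<^sup>2 / \<delta> ^ 3 * opt_gap n f (X t))))"
proof (rule exI[of _ 4], rule conjI, simp, rule exI[of _ 2000], rule conjI, simp,
    rule exI[of _ 8], rule conjI, simp, intro allI impI, rule conjI)
  fix n \<beta> f X v
  assume "convex_sym n f \<and> smooth_sym n \<beta> f \<and> frank_wolfe n \<beta> f X v"
  then interpret frank_wolfe_run n \<beta> f X v
    by unfold_locales auto
  show "\<forall>t\<ge>2. opt_gap n f (X t) \<le> 4 * (\<beta> / real t)"
    using sublinear_rate by blast
  show "\<forall>Xs \<delta>.
    2 \<le> n \<and> is_arg_min f (\<lambda>Y. Y \<in> spectrahedron n) Xs \<and>
    \<delta> = eigval (gradient n f Xs) (n - 1) - eigval (gradient n f Xs) n \<and> \<delta> > 0 \<longrightarrow>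
      (\<exists>T0::nat. real T0 \<le> 2000 * (\<beta> / \<delta>) ^ 3 \<and>
         (\<forall>t\<ge>1. t \<ge> T0 \<longrightarrow>
            opt_gap n f (X (Suc t)) \<le> opt_gap n f (X t) * (1 - min (\<delta> / (12 * \<beta>)) (1 / 2)))) \<and>
      (\<forall>t\<ge>1. (fro_norm (outer (v t) - Xs))\<^sup>2 \<le> 8 * (\<beta>\<^sup>2 / \<delta> ^ 3 * opt_gap n f (X t)))"
  proof (intro allI impI)
    fix Xs \<delta>
    assume "2 \<le> n \<and> is_arg_min f (\<lambda>Y. Y \<in> spectrahedron n) Xs \<and>
      \<delta> = eigval (gradient n f Xs) (n - 1) - eigval (gradient n f Xs) n \<and> \<delta> > 0"
    then interpret frank_wolfe_gap n \<beta> f X v Xs \<delta>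
      by unfold_locales auto
    \<comment> \<open>Rounding down keeps the threshold below 2000 (\<beta>/\<delta>)^3 even when
      that number is less than 1, where rounding up a positive value would exceed it.\<close>
    let ?T = "nat \<lfloor>2000 * (\<beta> / \<delta>) ^ 3\<rfloor>"
    have "real ?T \<le> 2000 * (\<beta> / \<delta>) ^ 3"
      using beta_nonneg gap_pos by simp
    then show "(\<exists>T0::nat. real T0 \<le> 2000 * (\<beta> / \<delta>) ^ 3 \<and>
         (\<forall>t\<ge>1. t \<ge> T0 \<longrightarrow>
            opt_gap n f (X (Suc t)) \<le> opt_gap n f (X t) * (1 - min (\<delta> / (12 * \<beta>)) (1 / 2)))) \<and>
      (\<forall>t\<ge>1. (fro_norm (outer (v t) - Xs))\<^sup>2 \<le> 8 * (\<beta>\<^sup>2 / \<delta> ^ 3 * opt_gap n f (X t)))"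
      using linear_progress eventually_close eigenvector_rate by blast
  qed
qed

end
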